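(* There exist universal constants $C_1,\dots,C_6>0$ such that the following holds. Let $d\ge1$ be an integer, let $\mathcal{J}\subset\mathbb{N}^d$ be a finite set with $N=\#(\mathcal{J})$, let $\alpha>1$, let $s$ be an integer with $1\le s\le N$, and let $\delta,\gamma,\gamma_0$ be positive reals with $0<\delta<1$ and $0<\gamma+\gamma_0<1$. Put $s_\alpha=(1+\alpha)^2 s$ and $$ C_{d,1}=C_1\Big(\frac4\pi\Big)^{4d},\quad C_{d,2}=\frac{C_2(d+1)}{((d-1)!)^{1/2}}\Big(\frac{64\sqrt2}{\pi^2}\Big)^d,\quad C_{d,3}=\frac{C_3(d+1)}{(d-1)!}\Big(\frac4\pi\Big)^{2d},\quad C_{d,4}=\frac{C_4(d+1)(d-1)^{d-1}}{(d-1)!}\cdot\frac{2^{4d}}{\pi^{3d/2}}. $$ Assume that the positive integer $m$ satisfies $$ \begin{aligned} m\ \ge\ s_\alpha^2\max\Big\{ &\frac{C_{d,1}}{\delta^{12}\gamma_0}\log^2\Big(\frac{C_{d,4}s_\alpha^{3/2}}{\delta^2}\Big)\log^2(2N)\Big(\log\Big(\frac{\pi^d}{4^d}\sqrt{\frac{m}{\gamma_0}}\Big)\Big)^{4d-4},\\ &\frac{C_{d,2}}{\delta^{15/2}}\log^{3/2}\Big(\frac{C_{d,4}s_\alpha^{3/2}}{\delta^2}\Big)\log(2N)\Big(\log\Big(C_5\,m\Big(\frac{\pi}{4}\Big)^d\Big)\Big)^{d-1},\\ &\frac{C_{d,3}}{\delta^4}\log\Big(\frac{C_{d,4}s_\alpha^{3/2}}{\delta^2}\Big)\log\Big(\frac{\log(C_{d,4}s_\alpha^{3/2}/\delta^2)}{\gamma\delta}\Big)\big(\log(C_6\,\pi^d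 m)\big)^{d-1}\Big\}. \end{aligned} $$ Let $y_1,\dots,y_m$ be drawn independently from the uniform distribution on $[-1,1]^d$. Then, with probability exceeding $1-(\gamma+\gamma_0)$, the normalized sampling matrix $A=\big(L_j(y_i)/\sqrt m\big)_{1\le i\le m,\ j\in\mathcal{J}}\in\mathbb{R}^{m\times N}$ satisfies $$ \|Az\|_2^2>(1-\delta)\|z\|_2^2\qquad\text{for all } z\in C(s;\alpha)\setminus\{0\}. $$
   Context: $\mathbb{N}=\{0,1,2,\dots\}$. For $j=(j_1,\dots,j_d)\in\mathbb{N}^d$, $L_j(y)=\prod_{k=1}^d L_{j_k}(y_k)$ is the tensor-product Legendre polynomial, where $L_{j_k}$ is the univariate Legendre polynomial of degree $j_k$ orthonormal with respect to the uniform probability measure on $[-1,1]$; thus $\{L_j\}$ is orthonormal with respect to the uniform probability measure on $[-1,1]^d$. Vectors $z\in\mathbb{R}^N$ are indexed by $\mathcal{J}$. For $S\subset\mathcal{J}$, $S^c=\mathcal{J}\setminus S$ and $z_S$ is the restriction of $z$ to $S$. For $S\subset\mathcal{J}$ with $\#(S)=s$ set $$C(S;\alpha)=\{z\in\mathbb{R}^N:\ \|z_{S^c}\|_1\le\alpha\sqrt{s}\,\|z_S\|_2\},\qquad C(s;\alpha)=\bigcup_{S\subset\mathcal{J},\ \#(S)=s}C(S;\alpha).$$ "Universal constant" means independent of all parameters ($d,m,N,s,\mathcal{J},\alpha,\delta,\gamma,\gamma_0$). Convention for $d=1$: zeroth powers equal $1$ (including $0^0=1$). *)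

theory Defs
  imports "HOL-Probability.Probability" "HOL-Computational_Algebra.Polynomial"
begin

section \<open>Orthonormal Legendre polynomials\<close>

text \<open>Rodrigues' formula gives the classical polynomial \<open>P\<^sub>n\<close> with \<open>P\<^sub>n(1) = 1\<close>; the factor
  \<open>sqrt (2 n + 1)\<close> normalizes it with respect to the uniform \<^emph>\<open>probability\<close> measure on \<open>[-1, 1]\<close>,
  see \<open>degree_legendre\<close> and \<open>legendre_orthonormal\<close> below.\<close>

definition legendre :: "nat \<Rightarrow> real poly" where
  "legendre n = smult (sqrt (2 * real n + 1) / (2 ^ n * fact n)) ((pderiv ^^ n) ([:-1, 0, 1:] ^ n))"

definition tensor_legendre :: "nat \<Rightarrow> (nat \<Rightarrow> nat) \<Rightarrow> (nat \<Rightarrow> real) \<Rightarrow> real" where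
  "tensor_legendre d j y = (\<Prod>k\<in>{1..d}. poly (legendre (j k)) (y k))"

lemma degree_legendre: "degree (legendre n) = n"
proof -
  have "degree ([:-1, 0, 1::real:] ^ n) = 2 * n"
    by (subst degree_power_eq) auto
  then show ?thesis
    by (simp add: legendre_def degree_higher_pderiv)
qed

abbreviation (input) integral_pm1 :: "real poly \<Rightarrow> real" where
  "integral_pm1 p \<equiv> (LINT x|lborel. poly p x * indicator {-1..1} x)"

lemma integrable_poly_pm1: "integrable lborel (\<lambda>x. poly p x * indicator {-1..1} (x::real))"
  using borel_integrable_atLeastAtMost[of "-1" 1 "poly p"]
  by (simp add: mult.commute indicator_def if_distrib cong: if_cong)

lemma integral_pm1_add: "integral_pm1 (p + q) = integral_pm1 p + integral_pm1 q"
  by (subst Bochner_Integration.integral_add[symmetric])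
     (simp_all add: integrable_poly_pm1 algebra_simps)

lemma integral_pm1_smult: "integral_pm1 (smult c p) = c * integral_pm1 p"
  by (subst integral_mult_right_zero[symmetric]) (simp add: mult.assoc)

lemma integral_pm1_pderiv: "integral_pm1 (pderiv p) = poly p 1 - poly p (-1)"
  by (rule integral_FTC_Icc_real) auto

lemma integral_pm1_by_parts:
  assumes "poly p 1 = 0" "poly p (-1) = 0"
  shows "integral_pm1 (pderiv p * q) = - integral_pm1 (p * pderiv q)"
proof -
  have "pderiv (p * q) = p * pderiv q + pderiv p * q"
    by (simp add: pderiv_mult mult.commute)
  then have "integral_pm1 (p * pderiv q) + integral_pm1 (pderiv p * q) = 0"
    using integral_pm1_pderiv[of "p * q"] integral_pm1_add[of "p * pderiv q" "pderiv p * q"] assms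
    by simp
  then show ?thesis by linarith
qed

lemma dvd_higher_pderiv_power:
  fixes w :: "real poly"
  assumes "k \<le> n"
  shows "w ^ (n - k) dvd (pderiv ^^ k) (w ^ n)"
  using assms
proof (induction k)
  case (Suc k)
  then obtain r where r: "(pderiv ^^ k) (w ^ n) = w ^ Suc (n - Suc k) * r"
    by (auto simp: dvd_def Suc_diff_Suc)
  have "pderiv (w ^ Suc (n - Suc k) * r)
      = w ^ (n - Suc k) * (w * pderiv r + r * smult (of_nat (Suc (n - Suc k))) (pderiv w))"
    unfolding pderiv_mult pderiv_power_Suc by (simp add: algebra_simps)
  then show ?case using r by simp
qed simp

lemma integral_rodrigues:
  assumes "k \<le> n"
  shows "integral_pm1 ((pderiv ^^ k) ([:-1, 0, 1:] ^ n) * q)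
       = (-1) ^ k * integral_pm1 ([:-1, 0, 1:] ^ n * (pderiv ^^ k) q)"
  using assms
proof (induction k arbitrary: q)
  case (Suc k)
  let ?p = "(pderiv ^^ k) ([:-1, 0, 1::real:] ^ n)"
  have "[:-1, 0, 1::real:] dvd [:-1, 0, 1::real:] ^ (n - k)"
    using Suc.prems by (intro dvd_power) auto
  then have "[:-1, 0, 1::real:] dvd ?p"
    using dvd_higher_pderiv_power[of k n "[:-1, 0, 1:]"] Suc.prems by (meson Suc_leD dvd_trans)
  then have "poly ?p 1 = 0" "poly ?p (-1) = 0"
    by (auto simp: dvd_def)
  then have "integral_pm1 (pderiv ?p * q) = - integral_pm1 (?p * pderiv q)"
    by (rule integral_pm1_by_parts)
  also have "integral_pm1 (?p * pderiv q)
      = (-1) ^ k * integral_pm1 ([:-1, 0, 1:] ^ n * (pderiv ^^ k) (pderiv q))"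
    using Suc by simp
  finally show ?case
    by (simp add: funpow_swap1)
qed simp

lemma integral_pm1_weight:
  "integral_pm1 ([:-1, 0, 1:] ^ n) = (-1) ^ n * 2 ^ (2 * n + 1) * (fact n)\<^sup>2 / fact (2 * n + 1)"
proof (induction n)
  case 0
  show ?case using integral_pm1_pderiv[of "[:0, 1:]"] by (simp add: pderiv_pCons)
next
  case (Suc n)
  let ?w = "[:-1, 0, 1::real:]"
  have "pderiv ([:0, 1:] * ?w ^ Suc n)
      = smult (2 * real n + 3) (?w ^ Suc n) + smult (2 * real n + 2) (?w ^ n)"
    unfolding poly_eq_poly_eq_iff[symmetric]
  proof
    fix x
    show "poly (pderiv ([:0, 1:] * ?w ^ Suc n)) x
        = poly (smult (2 * real n + 3) (?w ^ Suc n) + smult (2 * real n + 2) (?w ^ n)) x"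
      unfolding pderiv_mult pderiv_power_Suc
      by (simp add: pderiv_pCons algebra_simps)
  qed
  then have "(2 * real n + 3) * integral_pm1 (?w ^ Suc n) + (2 * real n + 2) * integral_pm1 (?w ^ n)
      = poly ([:0, 1:] * ?w ^ Suc n) 1 - poly ([:0, 1:] * ?w ^ Suc n) (-1)"
    using integral_pm1_pderiv[of "[:0, 1:] * ?w ^ Suc n"]
      integral_pm1_add[of "smult (2 * real n + 3) (?w ^ Suc n)" "smult (2 * real n + 2) (?w ^ n)"]
      integral_pm1_smult[of "2 * real n + 3" "?w ^ Suc n"]
      integral_pm1_smult[of "2 * real n + 2" "?w ^ n"]
    by simp
  then have rec: "integral_pm1 (?w ^ Suc n) = - (2 * real n + 2) / (2 * real n + 3) * integral_pm1 (?w ^ n)"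
    by (simp add: field_simps)
  have step: "- a / b * (e * K * f / F) = - e * (4 * K) * (a\<^sup>2 * f / 4) / (b * a * F)"
    if "a > 0" "b > 0" "F > 0" for a b e K f F :: real
    using that by (simp add: field_simps power2_eq_square)
  have "integral_pm1 (?w ^ Suc n) = - ((-1) ^ n) * (4 * 2 ^ (2 * n + 1))
      * ((2 * real n + 2)\<^sup>2 * (fact n)\<^sup>2 / 4) / ((2 * real n + 3) * (2 * real n + 2) * fact (2 * n + 1))"
    unfolding rec Suc by (rule step) simp_all
  also have "(2 * real n + 3) * (2 * real n + 2) * fact (2 * n + 1) = fact (2 * Suc n + 1)"
    by (simp add: algebra_simps)
  also have "(2 * real n + 2)\<^sup>2 * (fact n)\<^sup>2 / 4 = (fact (Suc n))\<^sup>2"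
    by (simp add: power2_eq_square algebra_simps)
  also have "4 * 2 ^ (2 * n + 1) = (2 ^ (2 * Suc n + 1) :: real)"
    by simp
  also have "- ((-1) ^ n) = ((-1) ^ Suc n :: real)"
    by simp
  finally show ?case .
qed

lemma uniform_pm1_eq_density:
  "uniform_measure lborel {-1..1::real} = density lborel (\<lambda>x. ennreal (indicator {-1..1} x / 2))"
  unfolding uniform_measure_def
  by (intro arg_cong[where f = "density lborel"] ext)
     (auto simp: indicator_def divide_ennreal[symmetric])

lemma borel_measurable_poly_real: "poly p \<in> borel_measurable (borel :: real measure)"
  by (intro borel_measurable_continuous_onI continuous_intros)

lemma integrable_uniform_pm1: "integrable (uniform_measure lborel {-1..1::real}) (poly p)"
proof -
  have "integrable lborel (\<lambda>x. indicator {-1..1} x / 2 * poly p x)"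
    using integrable_poly_pm1[of "smult (1 / 2) p"] by (simp add: mult_ac)
  then show ?thesis
    unfolding uniform_pm1_eq_density
    by (subst integrable_real_density) (auto simp: borel_measurable_poly_real)
qed

lemma integral_uniform_pm1:
  "(LINT x|uniform_measure lborel {-1..1}. poly p x) = integral_pm1 p / 2"
proof -
  have "(LINT x|uniform_measure lborel {-1..1}. poly p x)
      = (LINT x|lborel. indicator {-1..1} x / 2 * poly p x)"
    unfolding uniform_pm1_eq_density
    by (subst integral_real_density) (auto simp: borel_measurable_poly_real)
  also have "\<dots> = (LINT x|lborel. poly p x * indicator {-1..1} x / 2)"
    by (intro Bochner_Integration.integral_cong) simp_all
  finally show ?thesis
    by simp
qed

lemma legendre_orthonormal:
  "(LINT x|uniform_measure lborel {-1..1}. poly (legendre m) x * poly (legendre n) x)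
     = (if m = n then 1 else 0)"
proof -
  let ?w = "[:-1, 0, 1::real:]"
  let ?L = "\<lambda>m n. (LINT x|uniform_measure lborel {-1..1}. poly (legendre m) x * poly (legendre n) x)"
  define c where "c n = sqrt (2 * real n + 1) / (2 ^ n * fact n)" for n
  have L: "?L m n = c n / 2 * ((-1) ^ n * integral_pm1 (?w ^ n * (pderiv ^^ n) (legendre m)))" for m n
  proof -
    have "?L m n = (LINT x|uniform_measure lborel {-1..1}. poly (legendre n * legendre m) x)"
      by (simp add: mult.commute)
    also have "legendre n * legendre m = smult (c n) ((pderiv ^^ n) (?w ^ n) * legendre m)"
      by (simp add: legendre_def[of n] c_def)
    finally show ?thesis
      using integral_rodrigues[of n n "legendre m"]
      unfolding integral_uniform_pm1 integral_pm1_smult by simp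
  qed
  have lt: "?L m n = 0" if "m < n" for m n
  proof -
    have "(pderiv ^^ n) (legendre m) = 0"
      using that by (intro poly_eqI) (simp add: coeff_higher_pderiv coeff_eq_0 degree_legendre)
    then show ?thesis unfolding L by simp
  qed
  have eq: "?L n n = 1" for n
  proof -
    have deg: "degree (?w ^ n) = 2 * n"
      by (subst degree_power_eq) auto
    have lc: "coeff (?w ^ n) (2 * n) = 1"
      using lead_coeff_power[of ?w n] deg by simp
    have "(pderiv ^^ (2 * n)) (?w ^ n) = [:fact (2 * n):]"
    proof (rule poly_eqI)
      fix i
      show "coeff ((pderiv ^^ (2 * n)) (?w ^ n)) i = coeff [:fact (2 * n):] i"
        using lc deg
        by (cases i) (simp_all add: coeff_higher_pderiv pochhammer_fact coeff_eq_0)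
    qed
    moreover have "(pderiv ^^ n) (legendre n) = smult (c n) ((pderiv ^^ (2 * n)) (?w ^ n))"
      unfolding legendre_def c_def higher_pderiv_smult
      by (simp only: mult_2 funpow_add comp_def)
    ultimately have "?w ^ n * (pderiv ^^ n) (legendre n) = smult (c n * fact (2 * n)) (?w ^ n)"
      by simp
    then have "?L n n = c n / 2 * ((-1) ^ n * (c n * fact (2 * n) * integral_pm1 (?w ^ n)))"
      unfolding L by (simp only: integral_pm1_smult)
    also have "\<dots> = c n ^ 2 / 2 * fact (2 * n) * ((-1) ^ n * integral_pm1 (?w ^ n))"
      by (simp only: power2_eq_square mult_ac times_divide_eq_left times_divide_eq_right)
    also have "(-1) ^ n * integral_pm1 (?w ^ n)
        = ((-1) ^ n * (-1) ^ n) * 2 ^ (2 * n + 1) * (fact n)\<^sup>2 / fact (2 * n + 1)"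
      unfolding integral_pm1_weight by (simp only: mult.assoc times_divide_eq_right)
    also have "(-1) ^ n * (-1) ^ n = (1 :: real)"
      by (simp flip: power_mult_distrib)
    also have "(fact (2 * n + 1) :: real) = (2 * real n + 1) * fact (2 * n)"
      by simp
    also have "c n ^ 2 = (2 * real n + 1) / (2 ^ (2 * n) * (fact n)\<^sup>2)"
      by (simp add: c_def power_divide power_mult_distrib power_even_eq)
    also have "2 ^ (2 * n + 1) = 2 * (2 ^ (2 * n) :: real)"
      by simp
    finally have "?L n n = (2 * real n + 1) / (2 ^ (2 * n) * (fact n)\<^sup>2) / 2 * fact (2 * n)
        * (1 * (2 * 2 ^ (2 * n)) * (fact n)\<^sup>2 / ((2 * real n + 1) * fact (2 * n)))" .
    also have "\<dots> = 1"
    proof -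
      have "a / (K * f\<^sup>2) / 2 * F * (1 * (2 * K) * f\<^sup>2 / (a * F)) = 1"
        if "a > 0" "K > 0" "f > 0" "F > 0" for a K f F :: real
        using that by simp
      then show ?thesis by simp
    qed
    finally show ?thesis .
  qed
  show ?thesis
    using lt[of m n] lt[of n m] eq[of n] by (cases m n rule: linorder_cases) (auto simp: mult.commute)
qed

section \<open>Sampling\<close>

text \<open>Points of \<open>\<real>\<^sup>d\<close> and multi-indices in \<open>\<nat>\<^sup>d\<close> are extensional functions on \<open>{1..d}\<close>, so that
  \<open>d\<close> can be quantified over inside the theorem.\<close>

definition multi_indices :: "nat \<Rightarrow> (nat \<Rightarrow> nat) set" where
  "multi_indices d = {1..d} \<rightarrow>\<^sub>E UNIV"

definition uniform_cube :: "nat \<Rightarrow> (nat \<Rightarrow> real) measure" where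
  "uniform_cube d = uniform_measure (\<Pi>\<^sub>M k\<in>{1..d}. lborel) ({1..d} \<rightarrow>\<^sub>E {-1..1})"

lemma uniform_cube_eq_PiM: "uniform_cube d = (\<Pi>\<^sub>M k\<in>{1..d}. uniform_measure lborel {-1..1})"
proof -
  interpret U: prob_space "uniform_measure lborel {-1..1::real}"
    by (rule prob_space_uniform_measure) auto
  interpret P: product_sigma_finite "\<lambda>_::nat. uniform_measure lborel {-1..1::real}"
    by standard
  interpret L: product_sigma_finite "\<lambda>_::nat. lborel :: real measure"
    by standard
  show ?thesis
  proof (rule P.PiM_eqI)
    show "sets (uniform_cube d) = sets (\<Pi>\<^sub>M k\<in>{1..d}. uniform_measure lborel {-1..1})"
      unfolding uniform_cube_def by (auto intro!: sets_PiM_cong)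
  next
    fix A :: "nat \<Rightarrow> real set"
    assume "\<And>k. k \<in> {1..d} \<Longrightarrow> A k \<in> sets (uniform_measure lborel {-1..1})"
    then have A: "\<And>k. k \<in> {1..d} \<Longrightarrow> A k \<in> sets borel"
      by simp
    have cube: "emeasure (\<Pi>\<^sub>M k\<in>{1..d}. lborel) ({1..d} \<rightarrow>\<^sub>E {-1..1::real}) = 2 ^ d"
      by (subst L.emeasure_PiM) auto
    have "emeasure (uniform_cube d) (Pi\<^sub>E {1..d} A)
        = emeasure (\<Pi>\<^sub>M k\<in>{1..d}. lborel) (({1..d} \<rightarrow>\<^sub>E {-1..1}) \<inter> Pi\<^sub>E {1..d} A) / 2 ^ d"
      unfolding uniform_cube_def using A
      by (subst emeasure_uniform_measure) (auto simp flip: cube intro!: sets_PiM_I_finite)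
    also have "\<dots> = (\<Prod>k\<in>{1..d}. emeasure lborel ({-1..1} \<inter> A k)) / 2 ^ d"
      unfolding PiE_Int using A by (subst L.emeasure_PiM) auto
    also have "\<dots> = (\<Prod>k\<in>{1..d}. emeasure lborel ({-1..1} \<inter> A k) / 2)"
      by (simp add: divide_ennreal_def prod.distrib ennreal_inverse_power)
    also have "\<dots> = (\<Prod>k\<in>{1..d}. emeasure (uniform_measure lborel {-1..1}) (A k))"
      using A by (intro prod.cong) simp_all
    finally show "emeasure (uniform_cube d) (Pi\<^sub>E {1..d} A)
        = (\<Prod>k\<in>{1..d}. emeasure (uniform_measure lborel {-1..1}) (A k))" .
  qed simp
qed

lemma tensor_legendre_orthonormal:
  assumes "j \<in> multi_indices d" "j' \<in> multi_indices d"
  shows "(LINT y|uniform_cube d. tensor_legendre d j y * tensor_legendre d j' y)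
       = (if j = j' then 1 else 0)"
proof -
  interpret U: prob_space "uniform_measure lborel {-1..1::real}"
    by (rule prob_space_uniform_measure) auto
  interpret P: product_sigma_finite "\<lambda>_::nat. uniform_measure lborel {-1..1::real}"
    by standard
  have "(LINT y|uniform_cube d. tensor_legendre d j y * tensor_legendre d j' y)
      = (LINT y|uniform_cube d. (\<Prod>k\<in>{1..d}. poly (legendre (j k)) (y k) * poly (legendre (j' k)) (y k)))"
    by (simp add: tensor_legendre_def prod.distrib)
  also have "\<dots> = (\<Prod>k\<in>{1..d}. (LINT x|uniform_measure lborel {-1..1}.
      poly (legendre (j k)) x * poly (legendre (j' k)) x))"
    unfolding uniform_cube_eq_PiM
  proof (rule P.product_integral_prod)
    fix k
    show "integrable (uniform_measure lborel {-1..1})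
        (\<lambda>x. poly (legendre (j k)) x * poly (legendre (j' k)) x)"
      unfolding poly_mult[symmetric] by (rule integrable_uniform_pm1)
  qed simp
  also have "\<dots> = (if j = j' then 1 else 0)"
  proof (cases "j = j'")
    case False
    then obtain k where "k \<in> {1..d}" "j k \<noteq> j' k"
      using assms unfolding multi_indices_def by (meson PiE_ext)
    then show ?thesis
      using False unfolding legendre_orthonormal by (auto intro!: prod_zero)
  qed (simp add: legendre_orthonormal)
  finally show ?thesis .
qed

definition uniform_samples :: "nat \<Rightarrow> nat \<Rightarrow> (nat \<Rightarrow> nat \<Rightarrow> real) measure" where
  "uniform_samples d m = (\<Pi>\<^sub>M i\<in>{1..m}. uniform_cube d)"

definition sampling_matrix ::
  "nat \<Rightarrow> nat \<Rightarrow> (nat \<Rightarrow> nat \<Rightarrow> real) \<Rightarrow> nat \<Rightarrow> (nat \<Rightarrow> nat) \<Rightarrow> real" where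
  "sampling_matrix d m y i j = tensor_legendre d j (y i) / sqrt (real m)"

definition mat_vec :: "'j set \<Rightarrow> ('i \<Rightarrow> 'j \<Rightarrow> real) \<Rightarrow> ('j \<Rightarrow> real) \<Rightarrow> 'i \<Rightarrow> real" where
  "mat_vec J A z i = (\<Sum>j\<in>J. A i j * z j)"

section \<open>The cones\<close>

text \<open>\<open>\<real>\<^sup>N\<close>, indexed by \<open>J\<close>, consists of the functions vanishing outside \<open>J\<close>; its zero vector is
  the constant function \<open>0\<close>.  The Euclidean norm of \<open>z\<^sub>S\<close> is \<^term>\<open>L2_set z S\<close>.\<close>

definition vecs :: "'j set \<Rightarrow> ('j \<Rightarrow> real) set" where
  "vecs J = {z. \<forall>j. j \<notin> J \<longrightarrow> z j = 0}"

definition cone_on :: "'j set \<Rightarrow> 'j set \<Rightarrow> real \<Rightarrow> ('j \<Rightarrow> real) set" where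
  "cone_on J S \<alpha> =
     {z \<in> vecs J. (\<Sum>j\<in>J - S. \<bar>z j\<bar>) \<le> \<alpha> * sqrt (real (card S)) * L2_set z S}"

definition sparse_cone :: "'j set \<Rightarrow> nat \<Rightarrow> real \<Rightarrow> ('j \<Rightarrow> real) set" where
  "sparse_cone J s \<alpha> = (\<Union>S\<in>{S. S \<subseteq> J \<and> card S = s}. cone_on J S \<alpha>)"

section \<open>The dimension-dependent constants\<close>

definition const1 :: "real \<Rightarrow> nat \<Rightarrow> real" where
  "const1 C d = C * (4 / pi) ^ (4 * d)"

definition const2 :: "real \<Rightarrow> nat \<Rightarrow> real" where
  "const2 C d = C * (real d + 1) / sqrt (fact (d - 1)) * (64 * sqrt 2 / pi\<^sup>2) ^ d"

definition const3 :: "real \<Rightarrow> nat \<Rightarrow> real" where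
  "const3 C d = C * (real d + 1) / fact (d - 1) * (4 / pi) ^ (2 * d)"

definition const4 :: "real \<Rightarrow> nat \<Rightarrow> real" where
  "const4 C d = C * (real d + 1) * real (d - 1) ^ (d - 1) / fact (d - 1)
     * (2 ^ (4 * d) / pi powr (3 * real d / 2))"

end

theory Submission
  imports Defs
begin

text \<open>Only a lower bound on \<open>\<parallel>A z\<parallel>\<close> is needed, so samples may be discarded.  Sonin's monotonicity argument
  gives \<open>L\<^sub>n(x)\<^sup>2 \<le> 2 / sqrt (1 - x\<^sup>2)\<close>, hence products of tensor Legendre polynomials are dominated by
  \<open>2\<^sup>d / sqrt v\<close> with \<open>v(y) = \<Prod>\<^sub>k (1 - y\<^sub>k\<^sup>2)\<close>.  Keep only the samples with \<open>v \<ge> \<kappa>\<close>.  The finite moments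
  of \<open>v\<close> of order \<open>\<eta> - 1\<close> bound the bias of each entry of the truncated Gram matrix, as well as its
  variance, and Bernstein's inequality with a union bound over the entries makes all of them
  \<open>2 \<epsilon>\<close>-close to the identity, where \<open>\<epsilon> = \<delta> / (3 s\<^sub>\<alpha>)\<close>.  On the cone \<open>\<parallel>z\<parallel>\<^sub>1\<^sup>2 \<le> s\<^sub>\<alpha> \<parallel>z\<parallel>\<^sub>2\<^sup>2\<close>, so the quadratic
  form loses at most \<open>2 \<delta> / 3\<close>.  With \<open>\<eta>\<close> of order \<open>1 / R\<close>, where \<open>R\<close> is \<open>\<Lambda>\<close> if \<open>d = 1\<close> and the logarithm
  in the first term of the maximum if \<open>d \<ge> 2\<close>, the first term exceeds the required sample size.\<close>

section \<open>A uniform bound for Legendre polynomials\<close>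

text \<open>The starting point is \<open>(x^2 - 1) u' = 2 n x u\<close>. One differentiation gives
  the case \<open>k = 0\<close>, each further one an induction step; \<open>k = n\<close> is
  Legendre's equation for the polynomial in Rodrigues' formula.\<close>

lemma rodrigues_recurrence:
  fixes n k :: nat
  defines "u \<equiv> [:-1, 0, 1::real:] ^ n"
  shows "[:-1, 0, 1:] * (pderiv ^^ Suc (Suc k)) u
    = smult (2 * (real n - real k - 1)) ([:0, 1:] * (pderiv ^^ Suc k) u)
      + smult ((real k + 1) * (2 * real n - real k)) ((pderiv ^^ k) u)"
proof (induction k)
  case 0
  have "[:-1, 0, 1:] * pderiv u = smult (2 * real n) ([:0, 1:] * u)"
    unfolding u_def by (cases n) (simp_all add: pderiv_power_Suc pderiv_pCons algebra_simps del: power_Suc, simp add: algebra_simps)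
  then have "pderiv ([:-1, 0, 1:] * pderiv u) = pderiv (smult (2 * real n) ([:0, 1:] * u))"
    by simp
  then have "poly (pderiv ([:-1, 0, 1:] * pderiv u)) x = poly (pderiv (smult (2 * real n) ([:0, 1:] * u))) x" for x
    by simp
  from this[unfolded pderiv_mult pderiv_smult] show ?case
    unfolding poly_eq_poly_eq_iff[symmetric]
    by (intro ext) (simp add: pderiv_pCons algebra_simps)
next
  case (Suc k)
  then have "poly (pderiv ([:-1, 0, 1:] * (pderiv ^^ Suc (Suc k)) u)) x
    = poly (pderiv (smult (2 * (real n - real k - 1)) ([:0, 1:] * (pderiv ^^ Suc k) u)
      + smult ((real k + 1) * (2 * real n - real k)) ((pderiv ^^ k) u))) x" for x
    by simp
  from this[unfolded pderiv_mult pderiv_smult pderiv_add] show ?case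
    unfolding poly_eq_poly_eq_iff[symmetric]
    by (intro ext) (simp add: pderiv_pCons algebra_simps)
qed

lemma legendre_ode:
  "(1 - x\<^sup>2) * poly (pderiv (pderiv (legendre n))) x - 2 * x * poly (pderiv (legendre n)) x
    + real n * (real n + 1) * poly (legendre n) x = 0"
proof -
  define c where "c = sqrt (2 * real n + 1) / (2 ^ n * fact n)"
  define q where "q = (pderiv ^^ n) ([:-1, 0, 1::real:] ^ n)"
  have L: "legendre n = smult c q"
    by (simp add: legendre_def c_def q_def)
  have "poly ([:-1, 0, 1:] * pderiv (pderiv q)) x
    = poly (smult (-2) ([:0, 1:] * pderiv q) + smult ((real n + 1) * real n) q) x"
    using rodrigues_recurrence[of n n] by (simp add: q_def)
  then have "c * ((1 - x\<^sup>2) * poly (pderiv (pderiv q)) x - 2 * x * poly (pderiv q) x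
      + real n * (real n + 1) * poly q x) = c * 0"
    by (intro arg_cong[where f = "(*) c"]) (simp add: algebra_simps power2_eq_square)
  then show ?thesis
    unfolding L by (simp add: pderiv_smult algebra_simps)
qed

text \<open>Put x = cos \<theta> and g(\<theta>) = sqrt (sin \<theta>) p(cos \<theta>). The equation
  becomes g'' + \<phi> g = 0 with \<phi> = Q / (4 (1 - x^2)), and g' = A / (2 (1 - x^2)^(1/4)). So
  the function differentiated here is Sonin's g^2 + g'^2 / \<phi>, whose \<theta>-derivative is -
  \<phi>' g'^2 / \<phi>^2.\<close>

lemma sonin_derivative:
  fixes p :: "real poly" and n x :: real
  assumes ode: "(1 - x\<^sup>2) * poly (pderiv (pderiv p)) x - 2 * x * poly (pderiv p) x
      + n * (n + 1) * poly p x = 0"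
    and x: "\<bar>x\<bar> < 1"
  defines "A \<equiv> \<lambda>x. x * poly p x - 2 * (1 - x\<^sup>2) * poly (pderiv p) x"
    and "Q \<equiv> \<lambda>x. (2 * n + 1)\<^sup>2 * (1 - x\<^sup>2) + 1"
  shows "((\<lambda>x. sqrt (1 - x\<^sup>2) * ((poly p x)\<^sup>2 + (A x)\<^sup>2 / Q x)) has_real_derivative
      - (2 * x * (A x)\<^sup>2 / (sqrt (1 - x\<^sup>2) * (Q x)\<^sup>2))) (at x)"
proof -
  define P P' P'' where "P = poly p x" and "P' = poly (pderiv p) x" and "P'' = poly (pderiv (pderiv p)) x"
  define v where "v = 1 - x\<^sup>2"
  have v: "v > 0" using x by (simp add: v_def abs_square_less_1)
  have Q: "Q x > 0" using v by (auto simp: Q_def v_def intro!: add_nonneg_pos)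
  define A' where "A' = (1 + 2 * n * (n + 1)) * P + x * P'"
  have "(A has_real_derivative P + x * P' - 2 * (- 2 * x * P' + v * P'')) (at x)"
    unfolding A_def P_def P'_def P''_def v_def
    by (auto intro!: derivative_eq_intros)
  also have "P + x * P' - 2 * (- 2 * x * P' + v * P'') = A'"
    using ode unfolding A'_def P_def P'_def P''_def v_def by (simp add: algebra_simps)
  finally have dA: "(A has_real_derivative A') (at x)" .
  have dQ: "(Q has_real_derivative - 2 * (2 * n + 1)\<^sup>2 * x) (at x)"
    unfolding Q_def by (auto intro!: derivative_eq_intros)
  have ds: "((\<lambda>x. sqrt (1 - x\<^sup>2)) has_real_derivative - x / sqrt v) (at x)"
    using v unfolding v_def by (auto intro!: derivative_eq_intros simp: field_simps)
  have dP: "(poly p has_real_derivative P') (at x)"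
    unfolding P'_def by (rule poly_DERIV)
  define E where "E = P\<^sup>2 + (A x)\<^sup>2 / Q x"
  define E' where "E' = 2 * P * P' + (2 * A x * A' * Q x + (A x)\<^sup>2 * (2 * (2 * n + 1)\<^sup>2 * x)) / (Q x)\<^sup>2"
  have dE: "((\<lambda>x. (poly p x)\<^sup>2 + (A x)\<^sup>2 / Q x) has_real_derivative E') (at x)"
    using Q by (auto intro!: derivative_eq_intros dA dQ dP)
      (simp add: E'_def P_def P'_def power2_eq_square algebra_simps)
  have D: "((\<lambda>x. sqrt (1 - x\<^sup>2) * ((poly p x)\<^sup>2 + (A x)\<^sup>2 / Q x)) has_real_derivative
      - x / sqrt v * E + E' * sqrt v) (at x)"
    using DERIV_mult[OF ds dE] by (simp add: E_def P_def v_def algebra_simps)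
  \<comment> \<open>In terms of g this is g'' = - \<phi> g, and \<open>Ax\<close> below encodes g'.
    Together they cancel everything in the derivative except a multiple of
    \<open>x * (A x)^2\<close>.\<close>
  have key: "x * A x + 2 * v * A' = P * Q x"
    unfolding A_def A'_def Q_def v_def P_def P'_def by (simp add: algebra_simps power2_eq_square)
  have Qv: "2 * (2 * n + 1)\<^sup>2 * x * v = 2 * x * (Q x - 1)"
    by (simp add: Q_def v_def)
  have Ax: "A x = x * P - 2 * v * P'"
    by (simp add: A_def v_def P_def P'_def)
  have "(- x * E + v * E') * (Q x)\<^sup>2 = - x * P\<^sup>2 * (Q x)\<^sup>2 - x * (A x)\<^sup>2 * Q x
      + 2 * v * P * P' * (Q x)\<^sup>2 + 2 * v * A x * A' * Q x + (A x)\<^sup>2 * (2 * (2 * n + 1)\<^sup>2 * x * v)"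
    using Q by (simp add: E_def E'_def field_simps power2_eq_square)
  also have "\<dots> = Q x * (A x * (x * A x + 2 * v * A') - P * Q x * (x * P - 2 * v * P')) - 2 * x * (A x)\<^sup>2"
    unfolding Qv by (simp add: algebra_simps power2_eq_square)
  also have "\<dots> = - 2 * x * (A x)\<^sup>2"
    unfolding key Ax[symmetric] by simp
  finally have "- x * E + v * E' = - 2 * x * (A x)\<^sup>2 / (Q x)\<^sup>2"
    using Q by (simp add: field_simps)
  moreover have "- x / sqrt v * E + E' * sqrt v = (- x * E + v * E') / sqrt v"
    using v by (simp add: field_simps)
  ultimately have "- x / sqrt v * E + E' * sqrt v = - 2 * x * (A x)\<^sup>2 / (sqrt v * (Q x)\<^sup>2)"
    by simp
  then show ?thesis
    using D unfolding v_def by simp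
qed

text \<open>Sonin's function increases up to 0 and decreases afterwards, so its value at 0 is the
  maximum. It dominates the left side because \<open>A^2 / Q\<close> is nonnegative.\<close>

lemma sonin_bound:
  fixes p :: "real poly" and n x :: real
  assumes ode: "\<And>x. (1 - x\<^sup>2) * poly (pderiv (pderiv p)) x - 2 * x * poly (pderiv p) x
      + n * (n + 1) * poly p x = 0"
    and x: "\<bar>x\<bar> < 1"
  shows "sqrt (1 - x\<^sup>2) * (poly p x)\<^sup>2
    \<le> (poly p 0)\<^sup>2 + 4 * (poly (pderiv p) 0)\<^sup>2 / ((2 * n + 1)\<^sup>2 + 1)"
proof -
  define A where "A = (\<lambda>x. x * poly p x - 2 * (1 - x\<^sup>2) * poly (pderiv p) x)"
  define Q where "Q = (\<lambda>x. (2 * n + 1)\<^sup>2 * (1 - x\<^sup>2) + 1)"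
  define F where "F = (\<lambda>x. sqrt (1 - x\<^sup>2) * ((poly p x)\<^sup>2 + (A x)\<^sup>2 / Q x))"
  have F': "(F has_real_derivative - (2 * t * (A t)\<^sup>2 / (sqrt (1 - t\<^sup>2) * (Q t)\<^sup>2))) (at t)"
    if "\<bar>t\<bar> < 1" for t
    unfolding F_def A_def Q_def by (rule sonin_derivative[OF ode that])
  have sq: "t\<^sup>2 \<le> 1" if "\<bar>t\<bar> < 1" for t :: real
    using that by (simp add: abs_square_le_1)
  have "F x \<le> F 0"
  proof (cases "x \<ge> 0")
    case True
    show ?thesis
    proof (rule DERIV_nonpos_imp_nonincreasing[OF True], intro exI conjI)
      fix t assume "0 \<le> t" "t \<le> x"
      then show "(F has_real_derivative - (2 * t * (A t)\<^sup>2 / (sqrt (1 - t\<^sup>2) * (Q t)\<^sup>2))) (at t)"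
        "- (2 * t * (A t)\<^sup>2 / (sqrt (1 - t\<^sup>2) * (Q t)\<^sup>2)) \<le> 0"
        using x sq[of t] by (auto intro!: F' divide_nonneg_nonneg mult_nonneg_nonneg)
    qed
  next
    case False
    show ?thesis
    proof (rule DERIV_nonneg_imp_nondecreasing[of x 0], use False in simp, intro exI conjI)
      fix t assume t: "x \<le> t" "t \<le> 0"
      then have "2 * t * (A t)\<^sup>2 / (sqrt (1 - t\<^sup>2) * (Q t)\<^sup>2) \<le> 0"
        using x sq[of t] by (intro divide_nonpos_nonneg mult_nonpos_nonneg[of "2 * t"] mult_nonneg_nonneg) auto
      then show "0 \<le> - (2 * t * (A t)\<^sup>2 / (sqrt (1 - t\<^sup>2) * (Q t)\<^sup>2))"
        by linarith
      show "(F has_real_derivative - (2 * t * (A t)\<^sup>2 / (sqrt (1 - t\<^sup>2) * (Q t)\<^sup>2))) (at t)"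
        using x t by (intro F') auto
    qed
  qed
  also have "F 0 = (poly p 0)\<^sup>2 + 4 * (poly (pderiv p) 0)\<^sup>2 / ((2 * n + 1)\<^sup>2 + 1)"
    by (simp add: F_def A_def Q_def)
  finally have "F x \<le> \<dots>" .
  moreover have "sqrt (1 - x\<^sup>2) * (poly p x)\<^sup>2 \<le> F x"
    unfolding F_def using sq[OF x] by (intro mult_left_mono) (auto simp: Q_def)
  ultimately show ?thesis by linarith
qed

section \<open>Values at the origin and the bound uniform in the degree\<close>

lemma coeff_rodrigues_even: "coeff ([:-1, 0, 1::real:] ^ n) (2 * i) = (-1) ^ (n + i) * real (n choose i)"
proof (induction n arbitrary: i)
  case 0
  then show ?case by (cases i) auto
next
  case (Suc n)
  show ?case
  proof (cases i)
    case 0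
    then show ?thesis using Suc[of 0] by simp
  next
    case (Suc k)
    then show ?thesis
      using Suc.IH[of k] Suc.IH[of "Suc k"] by (simp add: algebra_simps)
  qed
qed

lemma coeff_rodrigues_odd: "coeff ([:-1, 0, 1::real:] ^ n) (Suc (2 * i)) = 0"
proof (induction n arbitrary: i)
  case (Suc n)
  show ?case
    using Suc[of i] Suc[of "i - 1"] by (cases i) simp_all
qed simp

text \<open>Values and slopes of Legendre polynomials at 0 are central binomial coefficients up to
  explicit factors. The induction combines the ratio \<open>2 (2 k + 1) / (k + 1)\<close> of
  consecutive coefficients with \<open>(2 k + 1) (2 k + 3) \<le> 4 (k + 1)^2\<close>.\<close>

lemma central_binomial_bound: "(2 * real k + 1) * (real ((2 * k) choose k))\<^sup>2 \<le> 16 ^ k"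
proof (induction k)
  case (Suc k)
  have "Suc k * ((2 * Suc k) choose Suc k) = 2 * (2 * k + 1) * ((2 * k) choose k)"
  proof -
    have "Suc k * (Suc (Suc (2 * k)) choose Suc k) = Suc (Suc (2 * k)) * (Suc (2 * k) choose k)"
      by (rule Suc_times_binomial)
    moreover have "Suc (2 * k) choose k = Suc (2 * k) choose Suc k"
      using binomial_symmetric[of k "Suc (2 * k)"] by (simp add: Suc_diff_le)
    moreover have "Suc k * (Suc (2 * k) choose Suc k) = Suc (2 * k) * (2 * k choose k)"
      by (rule Suc_times_binomial)
    ultimately have "Suc k * (Suc (Suc (2 * k)) choose Suc k) = 2 * (Suc (2 * k) * (2 * k choose k))"
      by (metis mult.assoc mult_2 mult_Suc_right add_Suc_right add_Suc numeral_2_eq_2 Suc_1 mult.left_commute)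
    then show ?thesis by simp
  qed
  then have *: "real (Suc k) * real ((2 * Suc k) choose Suc k) = 2 * (2 * real k + 1) * real ((2 * k) choose k)"
    by (metis (no_types, lifting) of_nat_1 of_nat_add of_nat_mult of_nat_numeral)
  define a where "a = real ((2 * k) choose k)"
  define b where "b = real ((2 * Suc k) choose Suc k)"
  define r where "r = real k"
  have ab: "(r + 1) * b = 2 * (2 * r + 1) * a" using * by (simp add: a_def b_def r_def add.commute)
  have r: "r \<ge> 0" by (simp add: r_def)
  have IH: "(2 * r + 1) * a\<^sup>2 \<le> 16 ^ k" using Suc by (simp add: a_def r_def)
  have "(r + 1)\<^sup>2 * ((2 * r + 3) * b\<^sup>2) = (2 * r + 3) * ((r + 1) * b)\<^sup>2"
    by (simp add: power_mult_distrib)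
  also have "\<dots> = 4 * ((2 * r + 3) * (2 * r + 1)) * ((2 * r + 1) * a\<^sup>2)"
    unfolding ab by (simp add: power2_eq_square algebra_simps)
  also have "\<dots> \<le> 4 * (4 * (r + 1)\<^sup>2) * 16 ^ k"
  proof (rule mult_mono[OF _ IH])
    show "4 * ((2 * r + 3) * (2 * r + 1)) \<le> 4 * (4 * (r + 1)\<^sup>2)"
      using r by (simp add: power2_eq_square algebra_simps)
  qed (use r in auto)
  finally have "(r + 1)\<^sup>2 * ((2 * r + 3) * b\<^sup>2) \<le> (r + 1)\<^sup>2 * 16 ^ Suc k" by simp
  then have "(2 * r + 3) * b\<^sup>2 \<le> 16 ^ Suc k"
    using r by (subst (asm) mult_le_cancel_left_pos) auto
  then show ?case by (simp add: b_def r_def algebra_simps)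
qed simp

lemma legendre_at_0:
  "poly (legendre n) 0 = sqrt (2 * real n + 1) / 2 ^ n * coeff ([:-1, 0, 1:] ^ n) n"
  "poly (pderiv (legendre n)) 0
    = sqrt (2 * real n + 1) / 2 ^ n * (real n + 1) * coeff ([:-1, 0, 1:] ^ n) (Suc n)"
proof -
  have 2: "pochhammer 2 n = (fact (Suc n) :: real)"
    using pochhammer_fact[of "Suc n", where 'a = real]
    by (simp add: pochhammer_rec)
  show "poly (legendre n) 0 = sqrt (2 * real n + 1) / 2 ^ n * coeff ([:-1, 0, 1:] ^ n) n"
    by (simp add: poly_0_coeff_0 legendre_def coeff_higher_pderiv pochhammer_fact[symmetric])
  show "poly (pderiv (legendre n)) 0
    = sqrt (2 * real n + 1) / 2 ^ n * (real n + 1) * coeff ([:-1, 0, 1:] ^ n) (Suc n)"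
    by (simp add: poly_0_coeff_0 coeff_pderiv legendre_def coeff_higher_pderiv 2)
qed

text \<open>By \<open>sonin_bound\<close> only the value and the slope at 0 matter. One of them
  vanishes by parity, the other reduces to \<open>central_binomial_bound\<close>.\<close>

lemma legendre_bound:
  assumes "\<bar>x\<bar> < 1"
  shows "sqrt (1 - x\<^sup>2) * (poly (legendre n) x)\<^sup>2 \<le> 2"
proof -
  have "(poly (legendre n) 0)\<^sup>2 + 4 * (poly (pderiv (legendre n)) 0)\<^sup>2 / ((2 * real n + 1)\<^sup>2 + 1) \<le> 2"
  proof (cases "even n")
    case True
    then obtain k where n: "n = 2 * k" by blast
    have "(poly (legendre n) 0)\<^sup>2 = (4 * real k + 1) * (real ((2 * k) choose k))\<^sup>2 / 16 ^ k"
      unfolding legendre_at_0 n coeff_rodrigues_even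
      by (simp add: power_mult_distrib power_divide power_mult[symmetric])
         (simp add: power_mult)
    also have "\<dots> \<le> (2 * ((2 * real k + 1) * (real ((2 * k) choose k))\<^sup>2)) / 16 ^ k"
      by (intro divide_right_mono) (auto simp: algebra_simps)
    also have "\<dots> \<le> 2"
      using central_binomial_bound[of k] by (simp add: field_simps)
    finally have "(poly (legendre n) 0)\<^sup>2 \<le> 2" .
    moreover have "poly (pderiv (legendre n)) 0 = 0"
      unfolding legendre_at_0 n coeff_rodrigues_odd by simp
    ultimately show ?thesis by simp
  next
    case False
    then obtain k where n: "n = Suc (2 * k)" by (metis oddE Suc_eq_plus1)
    define r b where "r = real k" and "b = real ((2 * Suc k) choose Suc k)"
    have r: "r \<ge> 0" by (simp add: r_def)
    have power_2k: "((2::real) ^ k) ^ 4 = 16 ^ k"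
      by (simp flip: power_mult add: mult.commute[of k]) (simp add: power_mult)
    \<comment> \<open>The middle entry of an even row of Pascal's triangle is twice its neighbour in
      the row above, so the slope at 0 is governed by a central coefficient too, with index
      \<open>Suc k\<close>.\<close>
    have "b = 2 * real (n choose Suc k)"
      using binomial_symmetric[of k "Suc (2 * k)"]
      by (simp add: b_def n Suc_diff_le)
    then have c: "coeff ([:-1, 0, 1::real:] ^ n) (Suc n) = (-1) ^ (n + Suc k) * (b / 2)"
      using coeff_rodrigues_even[of n "Suc k"] by (simp add: n)
    have "(poly (pderiv (legendre n)) 0)\<^sup>2 = (4 * r + 3) * (2 * r + 2)\<^sup>2 * b\<^sup>2 / 16 ^ Suc k"
      unfolding legendre_at_0 c
      using power_2k
      by (simp add: power_mult_distrib power_divide power_mult[symmetric] n r_def)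
         (simp add: power_mult field_simps)
    moreover have "b\<^sup>2 / 16 ^ Suc k \<le> 1 / (2 * r + 3)"
      using central_binomial_bound[of "Suc k"] r by (simp add: b_def r_def field_simps)
    ultimately have "(poly (pderiv (legendre n)) 0)\<^sup>2 \<le> (4 * r + 3) * (2 * r + 2)\<^sup>2 * (1 / (2 * r + 3))"
      using r by (metis (no_types, opaque_lifting) mult_left_mono times_divide_eq_right mult_nonneg_nonneg
          zero_le_power2 add_nonneg_nonneg zero_le_numeral)
    also have "\<dots> \<le> ((2 * real n + 1)\<^sup>2 + 1) / 2"
    proof -
      have "r * (r * r) \<ge> 0" using r by simp
      \<comment> \<open>Both sides have leading term \<open>16 r^3\<close>; the right side exceeds
        the left by \<open>4 r^2 + 6 r + 3\<close>.\<close>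
      then have "(4 * r + 3) * (2 * r + 2)\<^sup>2 \<le> ((4 * r + 3)\<^sup>2 + 1) / 2 * (2 * r + 3)"
        using r by (simp add: power2_eq_square algebra_simps)
      then show ?thesis using r by (simp add: n r_def field_simps)
    qed
    finally have "4 * (poly (pderiv (legendre n)) 0)\<^sup>2 \<le> 2 * ((2 * real n + 1)\<^sup>2 + 1)" by simp
    moreover have "(2 * real n + 1)\<^sup>2 + 1 > 0" by (simp add: add_nonneg_pos)
    ultimately have "4 * (poly (pderiv (legendre n)) 0)\<^sup>2 / ((2 * real n + 1)\<^sup>2 + 1) \<le> 2"
      by (simp add: pos_divide_le_eq)
    moreover have "poly (legendre n) 0 = 0"
      unfolding legendre_at_0 using coeff_rodrigues_odd[of n k] by (simp add: n)
    ultimately show ?thesis by simp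
  qed
  then show ?thesis
    using sonin_bound[OF legendre_ode assms, of n] by linarith
qed

section \<open>A Bernstein inequality\<close>

text \<open>For negative \<open>x\<close> and \<open>y = - x\<close> the claim reads
  \<open>1 \<le> exp y * (1 - y + y^2)\<close>, and the quadratic Taylor polynomial in place of
  \<open>exp y\<close> already suffices.\<close>

lemma exp_le_quadratic:
  fixes x :: real
  assumes "x \<le> 1"
  shows "exp x \<le> 1 + x + x\<^sup>2"
proof (cases "x \<ge> 0")
  case True
  then show ?thesis using assms by (rule exp_bound)
next
  case False
  define y where "y = - x"
  have y: "y > 0" using False by (simp add: y_def)
  have "1 \<le> (1 + y + y\<^sup>2 / 2) * (1 - y + y\<^sup>2)"
  proof -
    have "(1 + y + y\<^sup>2 / 2) * (1 - y + y\<^sup>2) = 1 + y\<^sup>2 / 2 + y ^ 3 / 2 + y ^ 4 / 2"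
      by (simp add: field_simps power2_eq_square power3_eq_cube power4_eq_xxxx)
    then show ?thesis using y by simp
  qed
  also have "\<dots> \<le> exp y * (1 - y + y\<^sup>2)"
  proof (rule mult_right_mono)
    show "1 + y + y\<^sup>2 / 2 \<le> exp y" using y by (intro exp_lower_Taylor_quadratic) simp
    have "0 \<le> (1 - y / 2)\<^sup>2 + 3 / 4 * y\<^sup>2" by simp
    also have "\<dots> = 1 - y + y\<^sup>2" by (simp add: power2_eq_square algebra_simps)
    finally show "0 \<le> 1 - y + y\<^sup>2" .
  qed
  finally have "exp x * 1 \<le> exp x * (exp y * (1 - y + y\<^sup>2))"
    by (intro mult_left_mono) auto
  also have "\<dots> = 1 + x + x\<^sup>2"
    by (simp add: y_def mult.assoc[symmetric] exp_add[symmetric])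
  finally show ?thesis by simp
qed

text \<open>Chernoff's method: by independence the exponential moment of the sum is a product. The
  hypothesis \<open>scale\<close> keeps \<open>t * X x\<close> below 1, where
  \<open>exp_le_quadratic\<close> applies, so the first two moments control the exponential moment.
  The second moment is not centred.\<close>

lemma (in prob_space) bernstein_upper_tail:
  fixes X :: "'a \<Rightarrow> real" and m :: nat
  assumes X [measurable]: "X \<in> borel_measurable M"
    and bounded: "\<And>x. x \<in> space M \<Longrightarrow> \<bar>X x\<bar> \<le> B"
    and mean: "expectation X \<le> \<mu>"
    and second_moment: "expectation (\<lambda>x. (X x)\<^sup>2) \<le> V"
    and V: "V > 0" and \<epsilon>: "\<epsilon> > 0" and scale: "\<epsilon> * B \<le> V"
  shows "measure (\<Pi>\<^sub>M i\<in>{1..m}. M)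
      {y \<in> space (\<Pi>\<^sub>M i\<in>{1..m}. M). real m * (\<mu> + \<epsilon>) \<le> (\<Sum>i\<in>{1..m}. X (y i))}
    \<le> exp (- (real m * \<epsilon>\<^sup>2 / (4 * V)))"
proof -
  interpret product_sigma_finite "\<lambda>_::nat. M" by standard
  \<comment> \<open>This value minimizes \<open>t^2 V - t \<epsilon>\<close>; the minimum is
    \<open>- \<epsilon>^2 / (4 V)\<close>.\<close>
  define t where "t = \<epsilon> / (2 * V)"
  have t: "t > 0" using V \<epsilon> by (simp add: t_def)
  have tX: "t * X x \<le> 1" if "x \<in> space M" for x
  proof -
    have "t * X x \<le> t * B" using bounded[OF that] t by (intro mult_left_mono) auto
    also have "\<dots> \<le> 1" using scale V by (simp add: t_def field_simps)
    finally show ?thesis .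
  qed
  have int_X: "integrable M X" using bounded by (intro integrable_const_bound[where B = B]) auto
  have int_X2: "integrable M (\<lambda>x. (X x)\<^sup>2)"
  proof (rule integrable_const_bound[where B = "B\<^sup>2"])
    show "AE x in M. norm ((X x)\<^sup>2) \<le> B\<^sup>2"
      using bounded by (intro AE_I2) (auto simp: abs_le_square_iff[symmetric] intro: order_trans[OF _ abs_ge_self])
  qed simp
  have int_exp: "integrable M (\<lambda>x. exp (t * X x))"
    using tX by (intro integrable_const_bound[where B = "exp 1"]) auto
  have "expectation (\<lambda>x. exp (t * X x)) \<le> expectation (\<lambda>x. 1 + t * X x + t\<^sup>2 * (X x)\<^sup>2)"
    using exp_le_quadratic[OF tX] int_exp int_X int_X2
    by (intro integral_mono) (auto simp: power_mult_distrib)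
  also have "\<dots> = 1 + t * expectation X + t\<^sup>2 * expectation (\<lambda>x. (X x)\<^sup>2)"
    using int_X int_X2 by (simp add: prob_space)
  also have "\<dots> \<le> 1 + (t * \<mu> + t\<^sup>2 * V)"
    using mean second_moment t by (auto intro!: add_mono mult_left_mono)
  also have "\<dots> \<le> exp (t * \<mu> + t\<^sup>2 * V)"
    by (rule exp_ge_add_one_self)
  finally have mgf: "expectation (\<lambda>x. exp (t * X x)) \<le> exp (t * \<mu> + t\<^sup>2 * V)" .
  let ?P = "\<Pi>\<^sub>M i\<in>{1..m}. M"
  let ?u = "\<lambda>y. \<Prod>i\<in>{1..m}. exp (t * X (y i))"
  have int_u: "integrable ?P ?u"
    by (intro product_integrable_prod int_exp) auto
  have "(\<integral>y. ?u y \<partial>?P) = (\<Prod>i\<in>{1..m}. expectation (\<lambda>x. exp (t * X x)))"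
    by (intro product_integral_prod int_exp) auto
  also have "\<dots> \<le> exp (t * \<mu> + t\<^sup>2 * V) ^ m"
    using mgf by (simp add: power_mono)
  finally have int_le: "(\<integral>y. ?u y \<partial>?P) \<le> exp (real m * (t * \<mu> + t\<^sup>2 * V))"
    by (simp add: exp_of_nat_mult)
  let ?c = "exp (t * (real m * (\<mu> + \<epsilon>)))"
  have "{y \<in> space ?P. real m * (\<mu> + \<epsilon>) \<le> (\<Sum>i\<in>{1..m}. X (y i))} = {y \<in> space ?P. ?c \<le> ?u y}"
    using t by (simp add: exp_sum[symmetric] sum_distrib_left[symmetric])
  also have "measure ?P \<dots> \<le> (\<integral>y. ?u y \<partial>?P) / ?c"
    by (rule integral_Markov_inequality_measure[where A = "{}"]) (use int_u in \<open>auto intro!: prod_nonneg\<close>)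
  also have "\<dots> \<le> exp (real m * (t * \<mu> + t\<^sup>2 * V)) / ?c"
    by (intro divide_right_mono int_le) simp
  also have "\<dots> = exp (real m * (t * \<mu> + t\<^sup>2 * V) - t * (real m * (\<mu> + \<epsilon>)))"
    by (simp add: exp_diff)
  also have "real m * (t * \<mu> + t\<^sup>2 * V) - t * (real m * (\<mu> + \<epsilon>)) = - (real m * \<epsilon>\<^sup>2 / (4 * V))"
    using V by (simp add: t_def field_simps power2_eq_square)
  finally show ?thesis .
qed

section \<open>Moments of truncated products\<close>

text \<open>Since \<open>1 - x^2 \<ge> 1 - abs x\<close> and the exponent is not positive, the
  weight is at most \<open>(1 - abs x) powr (\<eta> - 1)\<close>. The majorant \<open>h\<close> puts
  one such singularity at each endpoint, by translating and reflecting \<open>f\<close>, whose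
  integral is explicit.\<close>

lemma
  fixes \<eta> :: real
  assumes \<eta>: "0 < \<eta>" "\<eta> \<le> 1"
  shows integrable_weight_1d: "integrable (uniform_measure lborel {-1..1}) (\<lambda>x. (1 - x\<^sup>2) powr (\<eta> - 1))"
    and integral_weight_1d: "(LINT x|uniform_measure lborel {-1..1}. (1 - x\<^sup>2) powr (\<eta> - 1)) \<le> 2 / \<eta>"
proof -
  define f where "f x = x powr (\<eta> - 1) * indicator {0..2} x" for x :: real
  have [measurable]: "f \<in> borel_measurable borel" unfolding f_def by measurable
  have "f = (\<lambda>x. if x \<in> {0..2} then x powr (\<eta> - 1) else 0)"
    by (auto simp: f_def)
  then have "(f has_integral 2 powr \<eta> / \<eta>) UNIV"
    using has_integral_powr_from_0[of "\<eta> - 1" 2] \<eta> by (simp only: has_integral_restrict_UNIV) simp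
  moreover have f0: "0 \<le> f x" for x by (simp add: f_def)
  ultimately have nn: "(\<integral>\<^sup>+x. f x \<partial>lborel) = 2 powr \<eta> / \<eta>"
    by (intro nn_integral_has_integral_lborel) auto
  have f: "has_bochner_integral lborel f (2 powr \<eta> / \<eta>)"
    using nn \<eta> f0 by (intro has_bochner_integral_nn_integral) auto
  have f1: "has_bochner_integral lborel (\<lambda>x. f (1 + 1 * x)) (2 powr \<eta> / \<eta>)"
    using lborel_has_bochner_integral_real_affine_iff[of 1 f "2 powr \<eta> / \<eta>" 1] f by simp
  have f2: "has_bochner_integral lborel (\<lambda>x. f (1 + (-1) * x)) (2 powr \<eta> / \<eta>)"
    using lborel_has_bochner_integral_real_affine_iff[of "-1" f "2 powr \<eta> / \<eta>" 1] f by simp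
  define h where "h x = (f (1 + x) + f (1 - x)) / 2" for x
  have h: "has_bochner_integral lborel h (2 powr \<eta> / \<eta>)"
    using has_bochner_integral_divide_zero[OF has_bochner_integral_add[OF f1 f2], of 2] unfolding h_def by simp
  define g where "g x = indicator {-1..1} x / 2 * (1 - x\<^sup>2) powr (\<eta> - 1)" for x :: real
  have [measurable]: "g \<in> borel_measurable borel" unfolding g_def by measurable
  have g0: "0 \<le> g x" for x by (simp add: g_def)
  have gh: "g x \<le> h x" for x
  proof (cases "\<bar>x\<bar> < 1")
    case True
    have *: "(1 - x\<^sup>2) powr (\<eta> - 1) \<le> (1 - \<bar>x\<bar>) powr (\<eta> - 1)"
    proof (rule powr_mono2')
      have "1 - x\<^sup>2 = (1 - \<bar>x\<bar>) * (1 + \<bar>x\<bar>)"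
        by (simp add: algebra_simps power2_eq_square[symmetric])
      then show "1 - \<bar>x\<bar> \<le> 1 - x\<^sup>2"
        using True by (simp add: mult_le_cancel_left1)
    qed (use \<eta> True in auto)
    show ?thesis
      using * True
      by (cases "x \<ge> 0") (auto simp: g_def h_def f_def intro: order_trans add_increasing add_increasing2)
  next
    case False
    \<comment> \<open>At the endpoints the weight is \<open>0 powr (\<eta> - 1)\<close>, which is 0
      by convention.\<close>
    then have "g x = 0" by (auto simp: g_def indicator_def abs_if split: if_splits)
    then show ?thesis by (simp add: h_def f_def)
  qed
  have int_g: "integrable lborel g"
  proof (rule Bochner_Integration.integrable_bound)
    show "integrable lborel h" using h by (simp add: has_bochner_integral_iff)
    show "AE x in lborel. norm (g x) \<le> norm (h x)"
      using g0 gh by (intro AE_I2) (auto intro: order_trans[OF _ abs_ge_self])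
  qed simp
  show "integrable (uniform_measure lborel {-1..1}) (\<lambda>x. (1 - x\<^sup>2) powr (\<eta> - 1))"
    unfolding uniform_pm1_eq_density using int_g unfolding g_def
    by (subst integrable_real_density) auto
  have "(LINT x|uniform_measure lborel {-1..1}. (1 - x\<^sup>2) powr (\<eta> - 1)) = (LINT x|lborel. g x)"
    unfolding uniform_pm1_eq_density g_def
    by (subst integral_real_density) auto
  also have "\<dots> \<le> (LINT x|lborel. h x)"
    using h int_g gh by (intro integral_mono) (auto simp: has_bochner_integral_iff)
  also have "\<dots> = 2 powr \<eta> / \<eta>"
    using h by (simp add: has_bochner_integral_iff)
  also have "\<dots> \<le> 2 powr 1 / \<eta>"
    using \<eta> by (intro divide_right_mono powr_mono) auto
  finally show "(LINT x|uniform_measure lborel {-1..1}. (1 - x\<^sup>2) powr (\<eta> - 1)) \<le> 2 / \<eta>"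
    by simp
qed

lemma measurable_tensor_legendre [measurable]: "tensor_legendre d j \<in> borel_measurable (uniform_cube d)"
proof -
  have "tensor_legendre d j \<in> borel_measurable (\<Pi>\<^sub>M k\<in>{1..d}. borel)"
    unfolding tensor_legendre_def
    by (intro borel_measurable_prod measurable_compose[OF _ borel_measurable_poly_real]
        measurable_component_singleton)
  also have "borel_measurable (\<Pi>\<^sub>M k\<in>{1..d}. borel) = borel_measurable (uniform_cube d)"
    by (intro measurable_cong_sets) (auto simp: uniform_cube_def intro!: sets_PiM_cong)
  finally show ?thesis .
qed

lemma prob_space_uniform_cube: "prob_space (uniform_cube d)"
  unfolding uniform_cube_eq_PiM
  by (intro prob_space_PiM prob_space_uniform_measure) auto

lemma AE_uniform_cube_interior: "AE y in uniform_cube d. \<forall>k\<in>{1..d}. \<bar>y k\<bar> < 1"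
proof -
  have "AE x in uniform_measure lborel {-1..1}. \<bar>x\<bar> < (1::real)"
  proof (rule AE_uniform_measureI)
    show "AE x in lborel. x \<in> {-1..1} \<longrightarrow> \<bar>x\<bar> < (1::real)"
      using AE_lborel_singleton[of "1::real"] AE_lborel_singleton[of "-1::real"]
      by eventually_elim auto
  qed simp
  then show ?thesis
    unfolding uniform_cube_eq_PiM
    by (intro AE_finite_allI AE_PiM_component prob_space_uniform_measure) auto
qed

lemma
  fixes \<eta> :: real
  assumes \<eta>: "0 < \<eta>" "\<eta> \<le> 1"
  shows integrable_weight: "integrable (uniform_cube d) (\<lambda>y. \<Prod>k\<in>{1..d}. (1 - (y k)\<^sup>2) powr (\<eta> - 1))"
    and integral_weight: "(LINT y|uniform_cube d. (\<Prod>k\<in>{1..d}. (1 - (y k)\<^sup>2) powr (\<eta> - 1))) \<le> (2 / \<eta>) ^ d"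
proof -
  interpret U: prob_space "uniform_measure lborel {-1..1::real}"
    by (rule prob_space_uniform_measure) auto
  interpret P: product_sigma_finite "\<lambda>_::nat. uniform_measure lborel {-1..1::real}"
    by standard
  show "integrable (uniform_cube d) (\<lambda>y. \<Prod>k\<in>{1..d}. (1 - (y k)\<^sup>2) powr (\<eta> - 1))"
    unfolding uniform_cube_eq_PiM
    by (rule P.product_integrable_prod) (use integrable_weight_1d[OF \<eta>] in auto)
  have "(LINT y|uniform_cube d. (\<Prod>k\<in>{1..d}. (1 - (y k)\<^sup>2) powr (\<eta> - 1)))
      = (\<Prod>k\<in>{1..d}. (LINT x|uniform_measure lborel {-1..1}. (1 - x\<^sup>2) powr (\<eta> - 1)))"
    unfolding uniform_cube_eq_PiM
    by (rule P.product_integral_prod) (use integrable_weight_1d[OF \<eta>] in auto)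
  also have "\<dots> \<le> (2 / \<eta>) ^ d"
    using integral_weight_1d[OF \<eta>] by (simp add: power_mono)
  finally show "(LINT y|uniform_cube d. (\<Prod>k\<in>{1..d}. (1 - (y k)\<^sup>2) powr (\<eta> - 1))) \<le> (2 / \<eta>) ^ d" .
qed

lemma sqrt_prod: "sqrt (\<Prod>x\<in>A. f x) = (\<Prod>x\<in>A. sqrt (f x))"
  by (induction A rule: infinite_finite_induct) (simp_all add: real_sqrt_mult)

text \<open>Multiplying the one-dimensional bounds gives
  \<open>sqrt v * (tensor_legendre d j y)^2 \<le> 2 ^ d\<close> for every index;
  \<open>2 a b \<le> a^2 + b^2\<close> extends this to mixed products. One weight thus serves all
  entries of the Gram matrix.\<close>

lemma tensor_legendre_product_bound:
  assumes y: "\<And>k. k \<in> {1..d} \<Longrightarrow> \<bar>y k\<bar> < 1"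
  shows "\<bar>tensor_legendre d j y * tensor_legendre d j' y\<bar>
    \<le> 2 ^ d * (\<Prod>k\<in>{1..d}. 1 - (y k)\<^sup>2) powr (- (1 / 2))"
proof -
  define v where "v = (\<Prod>k\<in>{1..d}. 1 - (y k)\<^sup>2)"
  have v: "v > 0" unfolding v_def using y by (intro prod_pos) (auto simp: abs_square_less_1)
  have *: "sqrt v * (tensor_legendre d j y)\<^sup>2 \<le> 2 ^ d" for j
  proof -
    have "sqrt v * (tensor_legendre d j y)\<^sup>2
        = (\<Prod>k\<in>{1..d}. sqrt (1 - (y k)\<^sup>2) * (poly (legendre (j k)) (y k))\<^sup>2)"
      by (simp add: v_def tensor_legendre_def sqrt_prod prod.distrib prod_power_distrib)
    also have "\<dots> \<le> (\<Prod>k\<in>{1..d}. 2)"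
      using y legendre_bound by (intro prod_mono) (auto simp: abs_square_le_1 less_imp_le)
    finally show ?thesis by simp
  qed
  have "2 * \<bar>tensor_legendre d j y * tensor_legendre d j' y\<bar>
      \<le> (tensor_legendre d j y)\<^sup>2 + (tensor_legendre d j' y)\<^sup>2"
    using sum_squares_bound[of "\<bar>tensor_legendre d j y\<bar>" "\<bar>tensor_legendre d j' y\<bar>"]
    by (simp add: abs_mult)
  then have "sqrt v * (2 * \<bar>tensor_legendre d j y * tensor_legendre d j' y\<bar>)
      \<le> sqrt v * ((tensor_legendre d j y)\<^sup>2 + (tensor_legendre d j' y)\<^sup>2)"
    using v by (intro mult_left_mono) auto
  also have "\<dots> \<le> 2 ^ d + 2 ^ d"
    unfolding distrib_left by (intro add_mono *)
  finally have "sqrt v * \<bar>tensor_legendre d j y * tensor_legendre d j' y\<bar> \<le> 2 ^ d" by simp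
  then have "\<bar>tensor_legendre d j y * tensor_legendre d j' y\<bar> \<le> 2 ^ d / sqrt v"
    using v by (simp add: field_simps)
  also have "2 ^ d / sqrt v = 2 ^ d * v powr (- (1 / 2))"
    using v by (simp add: powr_minus powr_half_sqrt field_simps)
  finally show ?thesis by (simp add: v_def)
qed

section \<open>Truncated products: sup norm, second moment and bias\<close>

text \<open>The space of \<open>uniform_cube d\<close> also contains points outside the cube, where
  the product may be positive. The first condition excludes them, so that the sup bound holds at
  every point, as \<open>bernstein_upper_tail\<close> demands.\<close>

definition truncation :: "nat \<Rightarrow> real \<Rightarrow> (nat \<Rightarrow> real) set" where
  "truncation d \<kappa> = {y. (\<forall>k\<in>{1..d}. \<bar>y k\<bar> < 1) \<and> \<kappa> \<le> (\<Prod>k\<in>{1..d}. 1 - (y k)\<^sup>2)}"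

definition truncated_product ::
  "nat \<Rightarrow> real \<Rightarrow> (nat \<Rightarrow> nat) \<Rightarrow> (nat \<Rightarrow> nat) \<Rightarrow> (nat \<Rightarrow> real) \<Rightarrow> real" where
  "truncated_product d \<kappa> j j' y
    = indicator (truncation d \<kappa>) y * (tensor_legendre d j y * tensor_legendre d j' y)"

lemma measurable_truncated_product [measurable]:
  "truncated_product d \<kappa> j j' \<in> borel_measurable (uniform_cube d)"
proof -
  have [measurable]: "(\<lambda>y. y k) \<in> borel_measurable (uniform_cube d)" if "k \<in> {1..d}" for k
    using that unfolding uniform_cube_eq_PiM by measurable
  have [measurable]: "Measurable.pred (uniform_cube d) (\<lambda>y. y \<in> truncation d \<kappa>)"
    unfolding truncation_def mem_Collect_eq by measurable
  show ?thesis
    unfolding truncated_product_def by measurable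
qed

context
  fixes d :: nat and \<kappa> \<eta> :: real
  assumes \<kappa>: "\<kappa> > 0" and \<eta>: "0 < \<eta>" "\<eta> \<le> 1 / 2"
begin

lemma truncated_product_bounded: "\<bar>truncated_product d \<kappa> j j' y\<bar> \<le> 2 ^ d * \<kappa> powr (- (1 / 2))"
proof (cases "y \<in> truncation d \<kappa>")
  case True
  then have "\<bar>truncated_product d \<kappa> j j' y\<bar> \<le> 2 ^ d * (\<Prod>k\<in>{1..d}. 1 - (y k)\<^sup>2) powr (- (1 / 2))"
    using tensor_legendre_product_bound[of d y j j'] by (auto simp: truncated_product_def truncation_def)
  also have "\<dots> \<le> 2 ^ d * \<kappa> powr (- (1 / 2))"
    using True \<kappa> by (intro mult_left_mono powr_mono2') (auto simp: truncation_def)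
  finally show ?thesis .
qed (simp add: truncated_product_def)

lemma integrable_truncated_product: "integrable (uniform_cube d) (truncated_product d \<kappa> j j')"
proof -
  interpret prob_space "uniform_cube d" by (rule prob_space_uniform_cube)
  show ?thesis
    by (rule integrable_const_bound[where B = "2 ^ d * \<kappa> powr (- (1 / 2))"])
      (auto simp: truncated_product_bounded)
qed

lemma weight_eq:
  assumes "\<And>k. k \<in> {1..d} \<Longrightarrow> \<bar>y k\<bar> < (1 :: real)"
  shows "(\<Prod>k\<in>{1..d}. (1 - (y k)\<^sup>2) powr (\<eta> - 1)) = (\<Prod>k\<in>{1..d}. 1 - (y k)\<^sup>2) powr (\<eta> - 1)"
    and "(\<Prod>k\<in>{1..d}. 1 - (y k)\<^sup>2) > 0"
  using assms by (auto intro!: prod_powr_distrib[symmetric] prod_pos simp: abs_square_le_1 abs_square_less_1 less_imp_le)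

text \<open>With \<open>v\<close> the product of the \<open>1 - (y k)^2\<close>, the integrand is at
  most \<open>4 ^ d / v\<close>. Split \<open>1 / v\<close> into \<open>v powr (- \<eta>)\<close>,
  which is at most \<open>\<kappa> powr (- \<eta>)\<close> where the truncation keeps the point, and
  the weight \<open>v powr (\<eta> - 1)\<close>, which is integrable.\<close>

lemma truncated_product_second_moment:
  "(LINT y|uniform_cube d. (truncated_product d \<kappa> j j' y)\<^sup>2) \<le> 4 ^ d * \<kappa> powr (- \<eta>) * (2 / \<eta>) ^ d"
proof -
  interpret prob_space "uniform_cube d" by (rule prob_space_uniform_cube)
  have ae: "AE y in uniform_cube d. (truncated_product d \<kappa> j j' y)\<^sup>2
      \<le> 4 ^ d * \<kappa> powr (- \<eta>) * (\<Prod>k\<in>{1..d}. (1 - (y k)\<^sup>2) powr (\<eta> - 1))"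
  proof (rule AE_I2)
    fix y
    show "(truncated_product d \<kappa> j j' y)\<^sup>2
      \<le> 4 ^ d * \<kappa> powr (- \<eta>) * (\<Prod>k\<in>{1..d}. (1 - (y k)\<^sup>2) powr (\<eta> - 1))"
    proof (cases "y \<in> truncation d \<kappa>")
      case True
      define v where "v = (\<Prod>k\<in>{1..d}. 1 - (y k)\<^sup>2)"
      have y: "\<bar>y k\<bar> < 1" if "k \<in> {1..d}" for k
        using that True by (simp add: truncation_def)
      have v: "v > 0" "\<kappa> \<le> v" using weight_eq(2)[OF y] True by (auto simp: v_def truncation_def)
      have "\<bar>truncated_product d \<kappa> j j' y\<bar> \<le> 2 ^ d * v powr (- (1 / 2))"
        using tensor_legendre_product_bound[of d y j j', OF y] by (simp add: truncated_product_def True v_def)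
      then have "\<bar>truncated_product d \<kappa> j j' y\<bar>\<^sup>2 \<le> (2 ^ d * v powr (- (1 / 2)))\<^sup>2"
        by (intro power_mono) auto
      also have "\<dots> = (2 ^ d * 2 ^ d) * (v powr (- (1 / 2)) * v powr (- (1 / 2)))"
        by (simp only: power2_eq_square mult_ac)
      also have "2 ^ d * 2 ^ d = (4 ^ d :: real)"
        by (simp flip: power_mult_distrib)
      also have "v powr (- (1 / 2)) * v powr (- (1 / 2)) = v powr (- \<eta>) * v powr (\<eta> - 1)"
        by (simp flip: powr_add)
      also have "4 ^ d * \<dots> \<le> 4 ^ d * (\<kappa> powr (- \<eta>) * v powr (\<eta> - 1))"
        using v \<kappa> \<eta> by (intro mult_left_mono mult_right_mono powr_mono2') auto
      finally show ?thesis using weight_eq(1)[OF y] by (simp add: v_def mult.assoc)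
    qed (auto simp: truncated_product_def intro!: mult_nonneg_nonneg prod_nonneg)
  qed
  have int: "integrable (uniform_cube d) (\<lambda>y. 4 ^ d * \<kappa> powr (- \<eta>) * (\<Prod>k\<in>{1..d}. (1 - (y k)\<^sup>2) powr (\<eta> - 1)))"
    using integrable_weight[of \<eta> d] \<eta> by simp
  have "(LINT y|uniform_cube d. (truncated_product d \<kappa> j j' y)\<^sup>2)
      \<le> (LINT y|uniform_cube d. 4 ^ d * \<kappa> powr (- \<eta>) * (\<Prod>k\<in>{1..d}. (1 - (y k)\<^sup>2) powr (\<eta> - 1)))"
  proof (rule integral_mono_AE[OF _ int ae])
    show "integrable (uniform_cube d) (\<lambda>y. (truncated_product d \<kappa> j j' y)\<^sup>2)"
      using ae by (intro Bochner_Integration.integrable_bound[OF int]) (auto elim: eventually_mono intro: order_trans[OF _ abs_ge_self])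
  qed
  also have "\<dots> = 4 ^ d * \<kappa> powr (- \<eta>) * (LINT y|uniform_cube d. (\<Prod>k\<in>{1..d}. (1 - (y k)\<^sup>2) powr (\<eta> - 1)))"
    by simp
  also have "\<dots> \<le> 4 ^ d * \<kappa> powr (- \<eta>) * (2 / \<eta>) ^ d"
    using integral_weight[of \<eta> d] \<eta> by (intro mult_left_mono) auto
  finally show ?thesis .
qed

text \<open>By orthonormality the deviation is the integral over the discarded points, where
  \<open>v \<le> \<kappa>\<close>. There \<open>v powr (- (1 / 2))\<close> splits into
  \<open>v powr (1 / 2 - \<eta>)\<close>, at most \<open>\<kappa> powr (1 / 2 - \<eta>)\<close>, and
  the integrable weight.\<close>

lemma truncated_product_mean:
  assumes "j \<in> multi_indices d" "j' \<in> multi_indices d"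
  shows "\<bar>(LINT y|uniform_cube d. truncated_product d \<kappa> j j' y) - (if j = j' then 1 else 0)\<bar>
    \<le> 2 ^ d * \<kappa> powr (1 / 2 - \<eta>) * (2 / \<eta>) ^ d"
proof -
  let ?L = "\<lambda>y. tensor_legendre d j y * tensor_legendre d j' y"
  interpret prob_space "uniform_cube d" by (rule prob_space_uniform_cube)
  interpret U: prob_space "uniform_measure lborel {-1..1::real}"
    by (rule prob_space_uniform_measure) auto
  interpret P: product_sigma_finite "\<lambda>_::nat. uniform_measure lborel {-1..1::real}"
    by standard
  have int_L: "integrable (uniform_cube d) ?L"
    unfolding tensor_legendre_def prod.distrib[symmetric] uniform_cube_eq_PiM poly_mult[symmetric]
    by (intro P.product_integrable_prod integrable_uniform_pm1) auto
  have int: "integrable (uniform_cube d) (\<lambda>y. 2 ^ d * \<kappa> powr (1 / 2 - \<eta>) * (\<Prod>k\<in>{1..d}. (1 - (y k)\<^sup>2) powr (\<eta> - 1)))"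
    using integrable_weight[of \<eta> d] \<eta> by simp
  have ae: "AE y in uniform_cube d. \<bar>truncated_product d \<kappa> j j' y - ?L y\<bar>
      \<le> 2 ^ d * \<kappa> powr (1 / 2 - \<eta>) * (\<Prod>k\<in>{1..d}. (1 - (y k)\<^sup>2) powr (\<eta> - 1))"
    using AE_uniform_cube_interior
  proof eventually_elim
    case (elim y)
    define v where "v = (\<Prod>k\<in>{1..d}. 1 - (y k)\<^sup>2)"
    show ?case
    proof (cases "y \<in> truncation d \<kappa>")
      case False
      have y: "\<bar>y k\<bar> < 1" if "k \<in> {1..d}" for k
        using that elim by simp
      have v: "v > 0" "v \<le> \<kappa>" using weight_eq(2)[OF y] False y by (auto simp: v_def truncation_def)
      have "\<bar>truncated_product d \<kappa> j j' y - ?L y\<bar> \<le> 2 ^ d * v powr (- (1 / 2))"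
        using tensor_legendre_product_bound[of d y j j', OF y] by (simp add: truncated_product_def False v_def)
      also have "v powr (- (1 / 2)) = v powr (1 / 2 - \<eta>) * v powr (\<eta> - 1)"
        by (simp flip: powr_add)
      also have "2 ^ d * \<dots> \<le> 2 ^ d * (\<kappa> powr (1 / 2 - \<eta>) * v powr (\<eta> - 1))"
        using v \<kappa> \<eta> by (intro mult_left_mono mult_right_mono powr_mono2) auto
      finally show ?thesis using weight_eq(1)[OF y] by (simp add: v_def mult.assoc)
    qed (auto simp: truncated_product_def intro!: mult_nonneg_nonneg prod_nonneg)
  qed
  have "\<bar>(LINT y|uniform_cube d. truncated_product d \<kappa> j j' y) - (if j = j' then 1 else 0)\<bar>
      = \<bar>LINT y|uniform_cube d. truncated_product d \<kappa> j j' y - ?L y\<bar>"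
    using int_L integrable_truncated_product[of j j']
    by (subst Bochner_Integration.integral_diff) (auto simp: tensor_legendre_orthonormal[OF assms])
  also have "\<dots> \<le> (LINT y|uniform_cube d. \<bar>truncated_product d \<kappa> j j' y - ?L y\<bar>)"
    by (rule integral_abs_bound)
  also have "\<dots> \<le> (LINT y|uniform_cube d. 2 ^ d * \<kappa> powr (1 / 2 - \<eta>) * (\<Prod>k\<in>{1..d}. (1 - (y k)\<^sup>2) powr (\<eta> - 1)))"
    using int_L integrable_truncated_product[of j j'] int ae by (intro integral_mono_AE) auto
  also have "\<dots> = 2 ^ d * \<kappa> powr (1 / 2 - \<eta>) * (LINT y|uniform_cube d. (\<Prod>k\<in>{1..d}. (1 - (y k)\<^sup>2) powr (\<eta> - 1)))"
    by simp
  also have "\<dots> \<le> 2 ^ d * \<kappa> powr (1 / 2 - \<eta>) * (2 / \<eta>) ^ d"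
    using integral_weight[of \<eta> d] \<eta> by (intro mult_left_mono) auto
  finally show ?thesis .
qed

end

section \<open>The cone and measurability of the event\<close>

text \<open>For each rational point and each radius \<open>1 / (n + 1)\<close>, one point of
  \<open>K\<close> within that distance is selected, if there is any. The selected points lie in
  \<open>K\<close> itself, so they inherit inequalities valid on \<open>K\<close>.\<close>

lemma countable_dense_subset_vecs:
  fixes K :: "('j \<Rightarrow> real) set"
  assumes J: "finite J" and K: "K \<subseteq> vecs J"
  obtains D where "countable D" "D \<subseteq> K"
    "\<And>z. z \<in> K \<Longrightarrow> \<exists>w. (\<forall>n::nat. w n \<in> D) \<and> (\<forall>j. (\<lambda>n. w n j) \<longlonglongrightarrow> z j)"
proof -
  define near where "near q n z \<longleftrightarrow> z \<in> K \<and> (\<forall>j\<in>J. \<bar>z j - q j\<bar> < inverse (real (Suc n)))" for q z and n :: nat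
  define I where "I = {(q, n). q \<in> J \<rightarrow>\<^sub>E \<rat> \<and> (\<exists>z. near q n z)}"
  define D where "D = (\<lambda>(q, n). SOME z. near q n z) ` I"
  have some: "near q n (SOME z. near q n z)" if "(q, n) \<in> I" for q n
  proof (rule someI_ex[where P = "near q n"])
    show "\<exists>z. near q n z" using that by (auto simp: I_def)
  qed
  show ?thesis
  proof
    have "countable ((J \<rightarrow>\<^sub>E (\<rat> :: real set)) \<times> (UNIV :: nat set))"
      using J by (intro countable_SIGMA countable_PiE) (auto intro: countable_rat)
    then show "countable D"
      unfolding D_def I_def by (intro countable_image) (rule countable_subset, auto)
    show "D \<subseteq> K" using some by (auto simp: D_def near_def)
    fix z assume z: "z \<in> K"
    have "\<exists>w\<in>D. \<forall>j\<in>J. \<bar>w j - z j\<bar> < 2 * inverse (real (Suc n))" for n :: nat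
    proof -
      have "\<exists>r\<in>\<rat>. \<bar>z j - r\<bar> < inverse (real (Suc n))" for j
      proof -
        obtain r where "r \<in> \<rat>" "z j < r" "r < z j + inverse (real (Suc n))"
          using Rats_dense_in_real[of "z j" "z j + inverse (real (Suc n))"] by auto
        then show ?thesis by (intro bexI[of _ r]) auto
      qed
      then obtain r where r: "r j \<in> \<rat>" "\<bar>z j - r j\<bar> < inverse (real (Suc n))" for j
        by metis
      define q where "q = restrict r J"
      have q: "(q, n) \<in> I" using r z by (auto simp: I_def q_def near_def)
      let ?w = "SOME z. near q n z"
      have "?w \<in> D" using q by (auto simp: D_def)
      moreover have "\<bar>?w j - z j\<bar> < 2 * inverse (real (Suc n))" if "j \<in> J" for j
        using some[OF q] that r(2)[of j] by (fastforce simp: near_def q_def)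
      ultimately show ?thesis by blast
    qed
    then obtain w where w: "w n \<in> D" "j \<in> J \<Longrightarrow> \<bar>w n j - z j\<bar> < 2 * inverse (real (Suc n))" for n j
      by metis
    have "(\<lambda>n. w n j) \<longlonglongrightarrow> z j" for j
    proof (cases "j \<in> J")
      case True
      have "(\<lambda>n. w n j - z j) \<longlonglongrightarrow> 0"
      proof (rule Lim_null_comparison)
        show "\<forall>\<^sub>F n in sequentially. norm (w n j - z j) \<le> 2 * inverse (real (Suc n))"
          using w(2)[OF True] by (auto intro!: always_eventually less_imp_le)
        show "(\<lambda>n. 2 * inverse (real (Suc n))) \<longlonglongrightarrow> 0"
          using tendsto_mult[OF tendsto_const LIMSEQ_inverse_real_of_nat, of 2] by simp
      qed
      then show ?thesis using LIM_zero_iff by blast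
    next
      case False
      moreover have "w n \<in> vecs J" "z \<in> vecs J" for n
        using K \<open>D \<subseteq> K\<close> w(1)[of n] z by blast+
      ultimately have "w n j = z j" for n
        by (simp add: vecs_def)
      then show ?thesis by simp
    qed
    then show "\<exists>w. (\<forall>n::nat. w n \<in> D) \<and> (\<forall>j. (\<lambda>n. w n j) \<longlonglongrightarrow> z j)"
      using w(1) by blast
  qed
qed

text \<open>Compactness turns the strict inequality into a uniform gap \<open>1 / (n + 1)\<close>, which survives the
  passage to a countable dense subset.\<close>

lemma measurable_Ball_compact:
  fixes K :: "('j \<Rightarrow> real) set" and f :: "'a \<Rightarrow> ('j \<Rightarrow> real) \<Rightarrow> real"
  assumes J: "finite J" and K: "K \<subseteq> vecs J" "compact K"
    and meas: "\<And>z. (\<lambda>y. f y z) \<in> borel_measurable M"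
    and cont: "\<And>y. continuous_on UNIV (f y)"
    and seq: "\<And>y w z. (\<And>j. (\<lambda>n. w n j) \<longlonglongrightarrow> z j) \<Longrightarrow> (\<lambda>n. f y (w n)) \<longlonglongrightarrow> f y z"
  shows "{y \<in> space M. \<forall>z\<in>K. f y z > 0} \<in> sets M"
proof -
  obtain D where D: "countable D" "D \<subseteq> K"
    "\<And>z. z \<in> K \<Longrightarrow> \<exists>w. (\<forall>n::nat. w n \<in> D) \<and> (\<forall>j. (\<lambda>n. w n j) \<longlonglongrightarrow> z j)"
    by (rule countable_dense_subset_vecs[OF J K(1)]) (rule that)
  have "(\<forall>z\<in>K. f y z > 0) \<longleftrightarrow> (\<exists>n::nat. \<forall>z\<in>D. f y z \<ge> 1 / real (Suc n))" for y
  proof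
    assume pos: "\<forall>z\<in>K. f y z > 0"
    show "\<exists>n::nat. \<forall>z\<in>D. f y z \<ge> 1 / real (Suc n)"
    proof (cases "K = {}")
      case False
      then obtain z\<^sub>0 where z0: "z\<^sub>0 \<in> K" "\<And>z. z \<in> K \<Longrightarrow> f y z\<^sub>0 \<le> f y z"
        using continuous_attains_inf[OF K(2), of "f y"] continuous_on_subset[OF cont] by auto
      then obtain n :: nat where "1 / real (Suc n) < f y z\<^sub>0"
        using pos nat_approx_posE by blast
      then show ?thesis using z0(2) D(2) by (meson less_le_trans less_imp_le subset_iff)
    qed (use D in auto)
  next
    assume "\<exists>n::nat. \<forall>z\<in>D. f y z \<ge> 1 / real (Suc n)"
    then obtain n :: nat where n: "\<And>z. z \<in> D \<Longrightarrow> f y z \<ge> 1 / real (Suc n)" by blast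
    show "\<forall>z\<in>K. f y z > 0"
    proof
      fix z assume "z \<in> K"
      then obtain w where w: "\<And>i::nat. w i \<in> D" "\<And>j. (\<lambda>i. w i j) \<longlonglongrightarrow> z j"
        using D(3) by blast
      have "f y z \<ge> 1 / real (Suc n)"
        by (rule LIMSEQ_le_const[OF seq[OF w(2)]]) (use n w(1) in auto)
      then show "f y z > 0" by (rule less_le_trans[rotated]) simp
    qed
  qed
  moreover have "{y \<in> space M. \<exists>n::nat. \<forall>z\<in>D. f y z \<ge> 1 / real (Suc n)} \<in> sets M"
    using D(1) meas
    by (intro sets.sets_Collect_countable_Ex sets.sets_Collect_countable_Ball borel_measurable_le) auto
  ultimately show ?thesis by simp
qed

section \<open>Compactness and scaling of the cone\<close>

lemma closed_cone_on:
  fixes S :: "'j set"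
  shows "closed (cone_on J S \<alpha>)"
proof -
  have coord: "continuous_on UNIV (\<lambda>z :: 'j \<Rightarrow> real. z j)" for j by simp
  have "closed {z :: 'j \<Rightarrow> real. \<forall>j. j \<notin> J \<longrightarrow> z j = 0}"
    by (intro closed_Collect_all closed_Collect_imp open_Collect_const closed_Collect_eq coord continuous_on_const)
  moreover have "closed {z :: 'j \<Rightarrow> real. (\<Sum>j\<in>J - S. \<bar>z j\<bar>) \<le> \<alpha> * sqrt (real (card S)) * L2_set z S}"
    unfolding L2_set_def by (intro closed_Collect_le continuous_intros coord)
  moreover have "cone_on J S \<alpha> = {z. \<forall>j. j \<notin> J \<longrightarrow> z j = 0}
      \<inter> {z. (\<Sum>j\<in>J - S. \<bar>z j\<bar>) \<le> \<alpha> * sqrt (real (card S)) * L2_set z S}"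
    by (auto simp: cone_on_def vecs_def)
  ultimately show ?thesis by (simp add: closed_Int)
qed

text \<open>Functions carry the product topology, so the box with factor \<open>{0}\<close> outside
  \<open>J\<close> is compact by Tychonoff's theorem. The set is closed in it, the cone being a
  finite union of closed sets.\<close>

lemma compact_sparse_cone_sphere:
  assumes "finite J"
  shows "compact (sparse_cone J s \<alpha> \<inter> {z. L2_set z J = 1})"
proof -
  let ?B = "\<lambda>j. if j \<in> J then {-1..1} else {0 :: real}"
  have "compact (Pi\<^sub>E UNIV ?B)"
    unfolding compactin_euclidean_iff[symmetric] euclidean_product_topology[symmetric] compactin_PiE by auto
  moreover have "closed (sparse_cone J s \<alpha>)"
    unfolding sparse_cone_def using assms by (intro closed_UN) (auto intro: closed_cone_on)
  moreover have "closed {z :: _ \<Rightarrow> real. L2_set z J = 1}"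
    unfolding L2_set_def by (intro closed_Collect_eq continuous_intros continuous_on_product_coordinates)
  ultimately have "compact (Pi\<^sub>E UNIV ?B \<inter> (sparse_cone J s \<alpha> \<inter> {z. L2_set z J = 1}))"
    by (intro compact_Int_closed closed_Int)
  moreover have "sparse_cone J s \<alpha> \<inter> {z. L2_set z J = 1} \<subseteq> Pi\<^sub>E UNIV ?B"
  proof
    fix z assume z: "z \<in> sparse_cone J s \<alpha> \<inter> {z. L2_set z J = 1}"
    then have "\<bar>z j\<bar> \<le> 1" if "j \<in> J" for j
      using member_le_L2_set[OF assms that, of "\<lambda>j. \<bar>z j\<bar>"] by (simp add: L2_set_def)
    then show "z \<in> Pi\<^sub>E UNIV ?B"
      using z by (auto simp: sparse_cone_def cone_on_def vecs_def abs_le_iff)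
  qed
  ultimately show ?thesis by (simp add: Int_absorb1)
qed

lemma mat_vec_scale: "mat_vec J A (\<lambda>j. c * z j) = (\<lambda>i. c * mat_vec J A z i)"
  by (rule ext) (simp add: mat_vec_def sum_distrib_left mult_ac)

lemma L2_set_scale: "(L2_set (\<lambda>j. c * z j) A)\<^sup>2 = c\<^sup>2 * (L2_set z A)\<^sup>2"
  by (simp add: L2_set_def sum_nonneg power_mult_distrib sum_distrib_left)

lemma sparse_cone_scale:
  assumes "c > 0" "z \<in> sparse_cone J s \<alpha>"
  shows "(\<lambda>j. c * z j) \<in> sparse_cone J s \<alpha>"
proof -
  have "(\<Sum>j\<in>J - S. \<bar>c * z j\<bar>) = c * (\<Sum>j\<in>J - S. \<bar>z j\<bar>)"
    "L2_set (\<lambda>j. c * z j) S = c * L2_set z S" for S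
    using assms(1) by (auto simp: abs_mult sum_distrib_left L2_set_right_distrib)
  then show ?thesis
    using assms by (auto simp: sparse_cone_def cone_on_def vecs_def mult.left_commute mult.assoc[symmetric])
qed

text \<open>Both sides are homogeneous of degree two and the cone is invariant under positive
  scaling, so the compact unit sphere decides. Sets outside the sigma-algebra have measure 0 by
  convention, so a lower bound for the probability rests on this.\<close>

lemma measurable_lower_bound_on_cone:
  fixes A :: "'a \<Rightarrow> 'i \<Rightarrow> 'j \<Rightarrow> real"
  assumes J: "finite J" and A: "\<And>i j. i \<in> I \<Longrightarrow> j \<in> J \<Longrightarrow> (\<lambda>y. A y i j) \<in> borel_measurable M"
  shows "{y \<in> space M. \<forall>z\<in>sparse_cone J s \<alpha> - {\<lambda>_. 0}.
      (L2_set (mat_vec J (A y) z) I)\<^sup>2 > c * (L2_set z J)\<^sup>2} \<in> sets M"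
proof -
  define f where "f y z = (L2_set (mat_vec J (A y) z) I)\<^sup>2 - c * (L2_set z J)\<^sup>2" for y and z :: "'j \<Rightarrow> real"
  have f: "f y z = (\<Sum>i\<in>I. (\<Sum>j\<in>J. A y i j * z j)\<^sup>2) - c * (\<Sum>j\<in>J. (z j)\<^sup>2)" for y z
    by (simp add: f_def L2_set_def mat_vec_def sum_nonneg)
  have scale: "f y (\<lambda>j. a * z j) = a\<^sup>2 * f y z" for y z a
    unfolding f_def mat_vec_scale L2_set_scale by (simp add: algebra_simps)
  let ?K = "sparse_cone J s \<alpha> \<inter> {z. L2_set z J = 1}"
  have "{y \<in> space M. \<forall>z\<in>?K. f y z > 0} \<in> sets M"
  proof (rule measurable_Ball_compact[OF J])
    show "?K \<subseteq> vecs J" by (auto simp: sparse_cone_def cone_on_def)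
    show "compact ?K" by (rule compact_sparse_cone_sphere[OF J])
    show "(\<lambda>y. f y z) \<in> borel_measurable M" for z
      unfolding f using A by measurable
    show "continuous_on UNIV (f y)" for y
      unfolding f by (intro continuous_intros continuous_on_product_coordinates)
    show "(\<lambda>n. f y (w n)) \<longlonglongrightarrow> f y z" if "\<And>j. (\<lambda>n. w n j) \<longlonglongrightarrow> z j" for y w z
      unfolding f by (intro tendsto_intros that)
  qed
  moreover have "(\<forall>z\<in>?K. f y z > 0) \<longleftrightarrow> (\<forall>z\<in>sparse_cone J s \<alpha> - {\<lambda>_. 0}. f y z > 0)" for y
  proof (intro iffI ballI)
    fix z assume K: "\<forall>z\<in>?K. f y z > 0" and z': "z \<in> sparse_cone J s \<alpha> - {\<lambda>_. 0}"
    then have z: "z \<in> sparse_cone J s \<alpha>" and "z \<noteq> (\<lambda>_. 0)" by auto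
    then obtain j where "z j \<noteq> 0" by blast
    then have "L2_set z J \<noteq> 0"
      using J z by (auto simp: L2_set_eq_0_iff sparse_cone_def cone_on_def vecs_def)
    then have pos: "L2_set z J > 0" using L2_set_nonneg[of z J] by linarith
    define a where "a = inverse (L2_set z J)"
    have a: "a > 0" using pos by (simp add: a_def)
    have "L2_set (\<lambda>j. a * z j) J = 1"
      using pos a by (simp add: L2_set_right_distrib[symmetric] a_def)
    then have "f y (\<lambda>j. a * z j) > 0"
      using K sparse_cone_scale[OF a z] by blast
    then show "f y z > 0" using a by (simp add: scale zero_less_mult_iff)
  next
    fix z assume "\<forall>z\<in>sparse_cone J s \<alpha> - {\<lambda>_. 0}. f y z > 0" "z \<in> ?K"
    moreover from this(2) have "z \<noteq> (\<lambda>_. 0)" by (auto simp: L2_set_def)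
    ultimately show "f y z > 0" by blast
  qed
  ultimately show ?thesis by (simp add: f_def)
qed

text \<open>Cauchy-Schwarz on \<open>S\<close> contributes \<open>sqrt s\<close> and the cone
  inequality off \<open>S\<close> contributes \<open>\<alpha> * sqrt s\<close>. This is the origin
  of \<open>(1 + \<alpha>)^2 * s\<close>.\<close>

lemma sparse_cone_l1_bound:
  assumes J: "finite J" and \<alpha>: "\<alpha> \<ge> 0" and z: "z \<in> sparse_cone J s \<alpha>"
  shows "(\<Sum>j\<in>J. \<bar>z j\<bar>)\<^sup>2 \<le> (1 + \<alpha>)\<^sup>2 * real s * (L2_set z J)\<^sup>2"
proof -
  obtain S where S: "S \<subseteq> J" "card S = s" "(\<Sum>j\<in>J - S. \<bar>z j\<bar>) \<le> \<alpha> * sqrt (real s) * L2_set z S"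
    using z by (auto simp: sparse_cone_def cone_on_def)
  have fin: "finite S" using S(1) J finite_subset by blast
  have le: "L2_set z S \<le> L2_set z J"
    unfolding L2_set_def using S(1) J by (intro real_sqrt_le_mono sum_mono2) auto
  have "(\<Sum>j\<in>S. \<bar>z j\<bar>) \<le> sqrt (real s) * L2_set z S"
    using L2_set_mult_ineq[of "\<lambda>_. 1" z S] S(2) by (simp add: L2_set_def)
  then have "(\<Sum>j\<in>J. \<bar>z j\<bar>) \<le> (1 + \<alpha>) * sqrt (real s) * L2_set z S"
    using S(3) sum.subset_diff[OF S(1) J, of "\<lambda>j. \<bar>z j\<bar>"] by (simp add: algebra_simps)
  also have "\<dots> \<le> (1 + \<alpha>) * sqrt (real s) * L2_set z J"
    using le \<alpha> by (intro mult_left_mono) auto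
  finally have "(\<Sum>j\<in>J. \<bar>z j\<bar>)\<^sup>2 \<le> ((1 + \<alpha>) * sqrt (real s) * L2_set z J)\<^sup>2"
    by (intro power_mono) (auto intro: sum_nonneg)
  then show ?thesis by (simp add: power_mult_distrib)
qed

section \<open>The truncated Gram matrix\<close>

text \<open>Discarding samples only lowers the quadratic form. The rest differs from
  \<open>m\<close> times the squared Euclidean norm by at most \<open>m * \<epsilon>\<close> times
  the squared l1 norm, which the cone compares with the Euclidean one.\<close>

lemma truncated_gram_lower_bound:
  fixes J :: "(nat \<Rightarrow> nat) set"
  assumes J: "finite J" and m: "m \<ge> 1" and \<alpha>: "\<alpha> \<ge> 0" and \<epsilon>: "\<epsilon> \<ge> 0"
    and gram: "\<And>j j'. j \<in> J \<Longrightarrow> j' \<in> J \<Longrightarrow>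
      \<bar>(\<Sum>i\<in>{1..m}. truncated_product d \<kappa> j j' (y i)) - real m * (if j = j' then 1 else 0)\<bar> \<le> real m * \<epsilon>"
    and z: "z \<in> sparse_cone J s \<alpha>"
  shows "(L2_set (mat_vec J (sampling_matrix d m y) z) {1..m})\<^sup>2
    \<ge> (1 - \<epsilon> * ((1 + \<alpha>)\<^sup>2 * real s)) * (L2_set z J)\<^sup>2"
proof -
  let ?T = "truncated_product d \<kappa>"
  have L2: "(L2_set f A)\<^sup>2 = (\<Sum>i\<in>A. (f i)\<^sup>2)" for f :: "'b \<Rightarrow> real" and A
    by (simp add: L2_set_def sum_nonneg)
  have mv: "mat_vec J (sampling_matrix d m y) z = (\<lambda>i. (\<Sum>j\<in>J. tensor_legendre d j (y i) * z j) / sqrt (real m))"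
    by (rule ext) (simp add: mat_vec_def sampling_matrix_def sum_divide_distrib)
  have "real m * (L2_set (mat_vec J (sampling_matrix d m y) z) {1..m})\<^sup>2
      = (\<Sum>i\<in>{1..m}. (\<Sum>j\<in>J. tensor_legendre d j (y i) * z j)\<^sup>2)"
    using m by (simp add: L2 mv power_divide sum_divide_distrib[symmetric])
  also have "\<dots> \<ge> (\<Sum>i\<in>{1..m}. \<Sum>j\<in>J. \<Sum>j'\<in>J. z j * z j' * ?T j j' (y i))" (is "_ \<ge> ?Q")
  proof (rule sum_mono)
    fix i
    have "(\<Sum>j\<in>J. \<Sum>j'\<in>J. z j * z j' * ?T j j' (y i))
        = indicator (truncation d \<kappa>) (y i) * (\<Sum>j\<in>J. tensor_legendre d j (y i) * z j)\<^sup>2"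
      by (simp add: truncated_product_def power2_eq_square sum_product sum_distrib_left mult_ac)
    also have "\<dots> \<le> (\<Sum>j\<in>J. tensor_legendre d j (y i) * z j)\<^sup>2"
      by (simp add: indicator_def)
    finally show "(\<Sum>j\<in>J. \<Sum>j'\<in>J. z j * z j' * ?T j j' (y i))
      \<le> (\<Sum>j\<in>J. tensor_legendre d j (y i) * z j)\<^sup>2" .
  qed
  finally have lower: "?Q \<le> real m * (L2_set (mat_vec J (sampling_matrix d m y) z) {1..m})\<^sup>2" .
  have "?Q = (\<Sum>j\<in>J. \<Sum>j'\<in>J. \<Sum>i\<in>{1..m}. z j * z j' * ?T j j' (y i))"
    by (subst sum.swap) (intro sum.cong refl sum.swap)
  also have "\<dots> = (\<Sum>j\<in>J. \<Sum>j'\<in>J. z j * z j' * (\<Sum>i\<in>{1..m}. ?T j j' (y i)))"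
    by (simp add: sum_distrib_left)
  finally have Q: "?Q = \<dots>" .
  have diag: "real m * (L2_set z J)\<^sup>2 = (\<Sum>j\<in>J. \<Sum>j'\<in>J. z j * z j' * (real m * (if j = j' then 1 else 0)))"
    unfolding L2 sum_distrib_left
    using J by (simp add: power2_eq_square if_distrib mult_ac cong: if_cong)
  have "\<bar>?Q - real m * (L2_set z J)\<^sup>2\<bar>
      = \<bar>\<Sum>j\<in>J. \<Sum>j'\<in>J. z j * z j' * ((\<Sum>i\<in>{1..m}. ?T j j' (y i)) - real m * (if j = j' then 1 else 0))\<bar>"
    unfolding Q diag by (simp only: sum_subtractf right_diff_distrib)
  also have "\<dots> \<le> (\<Sum>j\<in>J. \<Sum>j'\<in>J. \<bar>z j * z j' * ((\<Sum>i\<in>{1..m}. ?T j j' (y i)) - real m * (if j = j' then 1 else 0))\<bar>)"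
    by (rule order_trans[OF sum_abs]) (intro sum_mono sum_abs)
  also have "\<dots> \<le> (\<Sum>j\<in>J. \<Sum>j'\<in>J. \<bar>z j\<bar> * \<bar>z j'\<bar> * (real m * \<epsilon>))"
    unfolding abs_mult by (intro sum_mono mult_left_mono gram) auto
  also have "\<dots> = real m * \<epsilon> * (\<Sum>j\<in>J. \<bar>z j\<bar>)\<^sup>2"
    by (simp add: power2_eq_square sum_product sum_distrib_left mult_ac)
  also have "\<dots> \<le> real m * \<epsilon> * ((1 + \<alpha>)\<^sup>2 * real s * (L2_set z J)\<^sup>2)"
    using \<epsilon> by (intro mult_left_mono sparse_cone_l1_bound[OF J \<alpha> z]) auto
  finally have "real m * ((1 - \<epsilon> * ((1 + \<alpha>)\<^sup>2 * real s)) * (L2_set z J)\<^sup>2) \<le> ?Q"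
    by (simp add: algebra_simps)
  then have "real m * ((1 - \<epsilon> * ((1 + \<alpha>)\<^sup>2 * real s)) * (L2_set z J)\<^sup>2)
      \<le> real m * (L2_set (mat_vec J (sampling_matrix d m y) z) {1..m})\<^sup>2"
    using lower by linarith
  then show ?thesis using m by simp
qed

text \<open>A union bound over \<open>N^2\<close> entries with two signs each;
  \<open>m_large\<close> says exactly that the Bernstein tails add up to at most
  \<open>p\<close>.\<close>

lemma lower_rip_probability:
  fixes J :: "(nat \<Rightarrow> nat) set" and \<delta> \<eta> \<alpha> p :: real
  assumes J: "J \<subseteq> multi_indices d" "finite J" and m: "m \<ge> 1" and \<alpha>: "\<alpha> \<ge> 0" and s: "s \<ge> 1"
    and \<delta>: "\<delta> > 0" and \<eta>: "0 < \<eta>" "\<eta> < 1 / 2"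
    and \<epsilon>_def: "\<epsilon> = \<delta> / (3 * ((1 + \<alpha>)\<^sup>2 * real s))"
    and V_def: "V = (8 / \<eta>) ^ d * ((4 / \<eta>) ^ d / \<epsilon>) powr (2 * \<eta> / (1 - 2 * \<eta>))"
    and m_large: "4 * V / \<epsilon>\<^sup>2 * ln (2 * (real (card J))\<^sup>2 / p) \<le> real m"
    and p: "p > 0"
  shows "\<P>(y in uniform_samples d m.
          \<forall>z \<in> sparse_cone J s \<alpha> - {\<lambda>_. 0}.
            (L2_set (mat_vec J (sampling_matrix d m y) z) {1..m})\<^sup>2
              > (1 - \<delta>) * (L2_set z J)\<^sup>2) \<ge> 1 - p"
proof (cases "J = {}")
  case True
  then have "z \<notin> sparse_cone J s \<alpha> - {\<lambda>_. 0}" for z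
    by (auto simp: sparse_cone_def cone_on_def vecs_def)
  then have all: "{y \<in> space (uniform_samples d m). \<forall>z \<in> sparse_cone J s \<alpha> - {\<lambda>_. 0}.
            (L2_set (mat_vec J (sampling_matrix d m y) z) {1..m})\<^sup>2
              > (1 - \<delta>) * (L2_set z J)\<^sup>2} = space (uniform_samples d m)"
    by blast
  have "prob_space (uniform_samples d m)"
    unfolding uniform_samples_def by (intro prob_space_PiM prob_space_uniform_cube)
  then show ?thesis
    unfolding all using p by (simp add: prob_space.prob_space)
next
  case False
  interpret C: prob_space "uniform_cube d" by (rule prob_space_uniform_cube)
  let ?M = "uniform_samples d m"
  interpret M: prob_space ?M
    unfolding uniform_samples_def by (intro prob_space_PiM prob_space_uniform_cube)
  have \<epsilon>: "\<epsilon> > 0" using \<delta> \<alpha> s by (simp add: \<epsilon>_def)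
  txt \<open>This \<open>\<kappa>\<close> makes the truncation bias exactly \<open>\<epsilon>\<close>, and then \<open>\<epsilon>\<close> times the sup norm of the
    truncated products is exactly the variance bound \<open>V\<close>, so that the Bernstein tail is Gaussian.\<close>
  define Y where "Y = (4 / \<eta>) ^ d / \<epsilon>"
  define \<kappa> where "\<kappa> = Y powr (- 2 / (1 - 2 * \<eta>))"
  have Y: "Y > 0" using \<eta> \<epsilon> by (simp add: Y_def)
  have \<kappa>: "\<kappa> > 0" using Y by (simp add: \<kappa>_def)
  have "\<kappa> powr (1 / 2 - \<eta>) = 1 / Y"
  proof -
    have "- 2 / (1 - 2 * \<eta>) * (1 / 2 - \<eta>) = - 1" using \<eta> by (simp add: field_simps)
    then show ?thesis unfolding \<kappa>_def powr_powr using Y by (simp only: powr_minus_divide) simp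
  qed
  also have "Y = 2 ^ d * (2 / \<eta>) ^ d / \<epsilon>"
    by (simp add: Y_def flip: power_mult_distrib)
  finally have bias: "2 ^ d * \<kappa> powr (1 / 2 - \<eta>) * (2 / \<eta>) ^ d = \<epsilon>"
    using \<eta> by (simp add: power_divide)
  have \<kappa>\<eta>: "\<kappa> powr (- \<eta>) = Y powr (2 * \<eta> / (1 - 2 * \<eta>))"
    by (simp add: \<kappa>_def powr_powr)
  have V: "V = 4 ^ d * \<kappa> powr (- \<eta>) * (2 / \<eta>) ^ d"
    unfolding V_def \<kappa>\<eta> Y_def[symmetric] by (simp add: power_mult_distrib[symmetric] power_divide)
  have Vpos: "V > 0" unfolding V using \<kappa> \<eta> by simp
  have scale: "\<epsilon> * (2 ^ d * \<kappa> powr (- (1 / 2))) = V"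
  proof -
    have "\<epsilon> * (2 ^ d * \<kappa> powr (- (1 / 2)))
        = (2 ^ d * 2 ^ d) * (\<kappa> powr (1 / 2 - \<eta>) * \<kappa> powr (- (1 / 2))) * (2 / \<eta>) ^ d"
      unfolding bias[symmetric] by (simp only: mult_ac)
    also have "2 ^ d * 2 ^ d = (4 ^ d :: real)" by (simp flip: power_mult_distrib)
    also have "\<kappa> powr (1 / 2 - \<eta>) * \<kappa> powr (- (1 / 2)) = \<kappa> powr (- \<eta>)"
      by (simp flip: powr_add)
    finally show ?thesis by (simp add: V)
  qed
  let ?T = "truncated_product d \<kappa>"
  let ?e = "\<lambda>j j'. if j = j' then 1 else (0 :: real)"
  \<comment> \<open>The sign \<open>\<sigma>\<close> turns a two-sided deviation into two upper
    tails. One \<open>\<epsilon>\<close> pays for the truncation bias, the other is the deviation in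
    Bernstein's inequality.\<close>
  define bad where "bad = (\<lambda>(j, j', \<sigma>). {y \<in> space ?M.
      real m * (\<sigma> * ?e j j' + \<epsilon> + \<epsilon>) \<le> (\<Sum>i\<in>{1..m}. \<sigma> * ?T j j' (y i))})"
  define I where "I = J \<times> J \<times> {1, -1 :: real}"
  have measurable_T [measurable]: "(\<lambda>y. ?T j j' (y i)) \<in> borel_measurable ?M" if "i \<in> {1..m}" for i j j'
    using that unfolding uniform_samples_def by measurable
  have bad_sets: "bad x \<in> sets ?M" for x
    unfolding bad_def by (cases x) (simp, measurable)
  have bad_prob: "measure ?M (bad x) \<le> exp (- (real m * \<epsilon>\<^sup>2 / (4 * V)))" if x: "x \<in> I" for x
  proof -
    obtain j j' \<sigma> where x': "x = (j, j', \<sigma>)" "j \<in> J" "j' \<in> J" "\<sigma> = 1 \<or> \<sigma> = -1"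
      using x by (auto simp: I_def)
    have \<sigma>2: "\<bar>\<sigma>\<bar> = 1" "\<sigma>\<^sup>2 = 1" using x'(4) by auto
    have j: "j \<in> multi_indices d" "j' \<in> multi_indices d" using x' J by auto
    show ?thesis
      unfolding x'(1) bad_def uniform_samples_def prod.case
    proof (rule C.bernstein_upper_tail[OF _ _ _ _ Vpos \<epsilon>])
      show "\<bar>\<sigma> * ?T j j' y\<bar> \<le> 2 ^ d * \<kappa> powr (- (1 / 2))" for y
        using truncated_product_bounded[OF \<kappa>] \<eta> \<sigma>2 by (simp add: abs_mult)
      have "\<bar>C.expectation (?T j j') - ?e j j'\<bar> \<le> \<epsilon>"
        using truncated_product_mean[OF \<kappa> _ _ j, of \<eta>] \<eta> unfolding bias by simp
      then show "C.expectation (\<lambda>y. \<sigma> * ?T j j' y) \<le> \<sigma> * ?e j j' + \<epsilon>"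
        using x'(4) by (auto simp: abs_le_iff)
      show "C.expectation (\<lambda>y. (\<sigma> * ?T j j' y)\<^sup>2) \<le> V"
        using truncated_product_second_moment[OF \<kappa>, of \<eta> d j j'] \<eta>
        unfolding V power_mult_distrib \<sigma>2 by simp
      show "\<epsilon> * (2 ^ d * \<kappa> powr (- (1 / 2))) \<le> V" using scale by simp
    qed measurable
  qed
  have finI: "finite I" using J by (simp add: I_def)
  define N where "N = real (card J)"
  have N: "N > 0" using False J by (simp add: N_def card_gt_0_iff)
  have "measure ?M (\<Union>x\<in>I. bad x) \<le> (\<Sum>x\<in>I. measure ?M (bad x))"
    by (intro M.finite_measure_subadditive_finite finI) (use bad_sets in auto)
  also have "\<dots> \<le> (\<Sum>x\<in>I. exp (- (real m * \<epsilon>\<^sup>2 / (4 * V))))"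
    by (intro sum_mono bad_prob)
  also have "\<dots> = 2 * N\<^sup>2 * exp (- (real m * \<epsilon>\<^sup>2 / (4 * V)))"
    using J by (simp add: I_def N_def power2_eq_square card_cartesian_product)
  also have "\<dots> \<le> p"
  proof -
    have "ln (2 * N\<^sup>2 / p) \<le> real m * \<epsilon>\<^sup>2 / (4 * V)"
      using m_large Vpos \<epsilon> by (simp add: N_def field_simps)
    then have "exp (ln (2 * N\<^sup>2 / p)) \<le> exp (real m * \<epsilon>\<^sup>2 / (4 * V))"
      by simp
    also have "exp (ln (2 * N\<^sup>2 / p)) = 2 * N\<^sup>2 / p"
      using N p by (intro exp_ln) auto
    finally have "2 * N\<^sup>2 / p \<le> exp (real m * \<epsilon>\<^sup>2 / (4 * V))" .
    then show ?thesis using p by (simp add: exp_minus field_simps)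
  qed
  finally have bad_small: "measure ?M (\<Union>x\<in>I. bad x) \<le> p" .
  let ?good = "{y \<in> space ?M. \<forall>z \<in> sparse_cone J s \<alpha> - {\<lambda>_. 0}.
            (L2_set (mat_vec J (sampling_matrix d m y) z) {1..m})\<^sup>2
              > (1 - \<delta>) * (L2_set z J)\<^sup>2}"
  have good_sets: "?good \<in> sets ?M"
  proof (rule measurable_lower_bound_on_cone[OF J(2)])
    fix i j assume "i \<in> {1..m}"
    then show "(\<lambda>y. sampling_matrix d m y i j) \<in> borel_measurable ?M"
      unfolding sampling_matrix_def uniform_samples_def by measurable
  qed
  have "space ?M - (\<Union>x\<in>I. bad x) \<subseteq> ?good"
  proof (intro subsetI CollectI conjI ballI)
    fix y assume y: "y \<in> space ?M - (\<Union>x\<in>I. bad x)"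
    then show "y \<in> space ?M" by simp
    fix z assume z: "z \<in> sparse_cone J s \<alpha> - {\<lambda>_. 0}"
    have "\<bar>(\<Sum>i\<in>{1..m}. ?T j j' (y i)) - real m * ?e j j'\<bar> \<le> real m * (2 * \<epsilon>)"
      if j: "j \<in> J" "j' \<in> J" for j j'
    proof -
      have "(j, j', 1) \<in> I" "(j, j', -1) \<in> I" using j by (auto simp: I_def)
      then have "y \<notin> bad (j, j', 1)" "y \<notin> bad (j, j', -1)" using y by auto
      then show ?thesis
        using y by (simp add: bad_def sum_negf algebra_simps abs_le_iff)
    qed
    then have "(L2_set (mat_vec J (sampling_matrix d m y) z) {1..m})\<^sup>2
      \<ge> (1 - 2 * \<epsilon> * ((1 + \<alpha>)\<^sup>2 * real s)) * (L2_set z J)\<^sup>2"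
      using z \<epsilon> by (intro truncated_gram_lower_bound[where \<kappa> = \<kappa>, OF J(2) m \<alpha>]) simp_all
    moreover have "2 * \<epsilon> * ((1 + \<alpha>)\<^sup>2 * real s) = 2 * \<delta> / 3"
      using \<alpha> s by (simp add: \<epsilon>_def)
    \<comment> \<open>The spare \<open>\<delta> / 3\<close> makes the inequality strict for nonzero
      \<open>z\<close>.\<close>
    moreover have "(1 - 2 * \<delta> / 3) * (L2_set z J)\<^sup>2 > (1 - \<delta>) * (L2_set z J)\<^sup>2"
    proof (rule mult_strict_right_mono)
      obtain j where "z j \<noteq> 0" using z by auto
      then have "L2_set z J \<noteq> 0"
        using J z by (auto simp: L2_set_eq_0_iff sparse_cone_def cone_on_def vecs_def)
      then show "(L2_set z J)\<^sup>2 > 0" by simp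
    qed (use \<delta> in simp)
    ultimately show "(L2_set (mat_vec J (sampling_matrix d m y) z) {1..m})\<^sup>2
              > (1 - \<delta>) * (L2_set z J)\<^sup>2" by simp
  qed
  then have "measure ?M (space ?M - (\<Union>x\<in>I. bad x)) \<le> measure ?M ?good"
    by (rule M.finite_measure_mono[OF _ good_sets])
  moreover have "measure ?M (space ?M - (\<Union>x\<in>I. bad x)) = 1 - measure ?M (\<Union>x\<in>I. bad x)"
    by (rule M.prob_compl) (use bad_sets finI in auto)
  ultimately show ?thesis using bad_small by linarith
qed

section \<open>Sample size\<close>

text \<open>The exponent of the power is at most \<open>1 / R\<close>, whereas
  \<open>ln Y \<le> (3 d + 1) R\<close>, so this power costs only \<open>exp (3 d + 1)\<close>. The
  main cost is \<open>(8 / \<eta>) ^ d = (32 R) ^ d\<close>. The base 864 is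
  \<open>32 * 3 ^ 3\<close>, with 3 in place of e.\<close>

lemma truncation_variance_bound:
  fixes R \<epsilon> :: real
  assumes R: "R \<ge> 1" and \<epsilon>: "0 < \<epsilon>" "\<epsilon> \<le> 1" "ln (1 / \<epsilon>) \<le> R" and \<eta>: "\<eta> = 1 / (4 * R)"
  shows "(8 / \<eta>) ^ d * ((4 / \<eta>) ^ d / \<epsilon>) powr (2 * \<eta> / (1 - 2 * \<eta>)) \<le> 3 * (864 * R) ^ d"
proof -
  define Y where "Y = (4 / \<eta>) ^ d / \<epsilon>"
  have eta_inv: "4 / \<eta> = 16 * R" "8 / \<eta> = 32 * R" by (simp_all add: \<eta>)
  have "(16 * R) ^ d \<ge> 1" using R by (intro one_le_power) auto
  then have Y: "Y \<ge> 1" using \<epsilon> by (simp add: Y_def eta_inv)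
  have "2 * \<eta> / (1 - 2 * \<eta>) = 1 / (2 * R - 1)"
    using R by (simp add: \<eta> field_simps)
  also have "\<dots> \<le> 1 / R" using R by (intro divide_left_mono) auto
  finally have "Y powr (2 * \<eta> / (1 - 2 * \<eta>)) \<le> Y powr (1 / R)"
    using Y by (intro powr_mono)
  also have "\<dots> = exp (ln Y / R)" using Y by (simp add: powr_def)
  also have "\<dots> \<le> exp (3 * real d + 1)"
  proof -
    have "ln (16 * R) = 4 * ln 2 + ln R"
      using R ln_realpow[of 2 4] by (simp add: ln_mult)
    also have "\<dots> \<le> 4 * (25 / 36) + (R - 1)"
      using ln2_le_25_over_36 ln_le_minus_one[of R] R by (intro add_mono mult_left_mono) auto
    also have "\<dots> \<le> 3 * R" using R by simp
    finally have "real d * ln (16 * R) \<le> real d * (3 * R)" by (intro mult_left_mono) auto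
    moreover have "ln Y = ln ((16 * R) ^ d) - ln \<epsilon>"
      unfolding Y_def eta_inv using R \<epsilon> by (subst ln_div) auto
    moreover have "ln ((16 * R) ^ d) = real d * ln (16 * R)"
      by (rule ln_realpow)
    moreover have "ln (1 / \<epsilon>) = - ln \<epsilon>" using \<epsilon> by (simp add: ln_div)
    ultimately have "ln Y \<le> (3 * real d + 1) * R" using \<epsilon>(3) by (simp add: algebra_simps)
    then show ?thesis using R by (simp add: field_simps)
  qed
  also have "\<dots> = exp 1 * (exp 1 ^ 3) ^ d"
    unfolding power_mult[symmetric] exp_of_nat_mult[symmetric] exp_add[symmetric] by simp
  also have "\<dots> \<le> 3 * (3 ^ 3) ^ d"
    using exp_le by (intro mult_mono power_mono) auto
  finally have "Y powr (2 * \<eta> / (1 - 2 * \<eta>)) \<le> 3 * 27 ^ d" by simp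
  then have "(32 * R) ^ d * Y powr (2 * \<eta> / (1 - 2 * \<eta>)) \<le> (32 * R) ^ d * (3 * 27 ^ d)"
    using R by (intro mult_left_mono) auto
  also have "\<dots> = 3 * (864 * R) ^ d"
    using power_mult_distrib[of 27 "32 :: real" d] by (simp add: power_mult_distrib)
  finally show ?thesis by (simp add: Y_def eta_inv)
qed

section \<open>Constants and logarithms in the sample size\<close>

lemma fact_le_self_power: "fact n \<le> (real n) ^ n"
  using fact_le_power[of n, where 'a = real] by simp

text \<open>Each factor depending on \<open>d\<close> is at least 1, since \<open>n ^ n\<close>
  dominates \<open>fact n\<close> and \<open>2 ^ (4 * d) = 16 ^ d\<close> dominates
  \<open>(pi^2) ^ d\<close>. This keeps \<open>\<Lambda>\<close> large in every dimension.\<close>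

lemma const4_ge:
  assumes "C \<ge> 0"
  shows "const4 C d \<ge> C"
proof -
  have "pi powr (3 * real d / 2) \<le> pi powr (2 * real d)"
    using pi_gt3 by (intro powr_mono) auto
  also have "\<dots> = (pi\<^sup>2) ^ d"
    using powr_realpow[OF pi_gt_zero, of "2 * d"] by (simp add: power_mult)
  also have "\<dots> \<le> 16 ^ d"
    using pi_less_4 power_mono[of pi 4 2] by (intro power_mono) auto
  finally have "pi powr (3 * real d / 2) \<le> 2 ^ (4 * d)"
    by (simp add: power_mult)
  then have a: "2 ^ (4 * d) / pi powr (3 * real d / 2) \<ge> 1" by simp
  have b: "real (d - 1) ^ (d - 1) / fact (d - 1) \<ge> 1"
    using fact_le_self_power[of "d - 1"] by simp
  have "C * 1 * 1 * 1 \<le> C * (real d + 1) * (real (d - 1) ^ (d - 1) / fact (d - 1))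
     * (2 ^ (4 * d) / pi powr (3 * real d / 2))"
    using a b assms by (intro mult_mono mult_nonneg_nonneg) auto
  then show ?thesis by (simp add: const4_def)
qed

text \<open>The third term of the maximum keeps the logarithm in the first term away from \<open>0\<close>: its factor
  \<open>(4 / \<pi>)\<^sup>2\<^sup>d\<close> cancels the factor \<open>(\<pi> / 4)\<^sup>d\<close> inside that logarithm.\<close>

lemma log_term_large:
  fixes S \<delta> \<gamma> \<gamma>\<^sub>0 \<Lambda> :: real
  assumes d: "d \<ge> 1" and m: "m \<ge> 1" and S: "S > 0" and \<delta>: "0 < \<delta>" "\<delta> < 1" and \<gamma>: "0 < \<gamma>" "\<gamma> < 1"
    and \<gamma>0: "0 < \<gamma>\<^sub>0" "\<gamma>\<^sub>0 < 1" and \<Lambda>: "\<Lambda> \<ge> 3"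
    and m_large: "real m \<ge> S\<^sup>2 * (const3 (exp 2000) d / \<delta> ^ 4 * \<Lambda> * ln (\<Lambda> / (\<gamma> * \<delta>))
          * (ln (1 * pi ^ d * real m)) ^ (d - 1))"
  shows "ln (pi ^ d / 4 ^ d * sqrt (real m / \<gamma>\<^sub>0)) \<ge> 1000 + ln (S / \<delta>\<^sup>2)"
proof -
  have "ln (\<Lambda> / (\<gamma> * \<delta>)) \<ge> ln (exp 1)"
  proof (rule ln_mono)
    have "\<gamma> * \<delta> \<le> 1 * 1" using \<gamma> \<delta> by (intro mult_mono) auto
    then have "\<Lambda> * (\<gamma> * \<delta>) \<le> \<Lambda> * 1" using \<Lambda> by (intro mult_left_mono) auto
    then have "\<Lambda> \<le> \<Lambda> / (\<gamma> * \<delta>)" using \<gamma> \<delta> by (simp add: pos_le_divide_eq)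
    then show "exp 1 \<le> \<Lambda> / (\<gamma> * \<delta>)" using \<Lambda> exp_le by linarith
  qed auto
  then have ln1: "ln (\<Lambda> / (\<gamma> * \<delta>)) \<ge> 1" by simp
  \<comment> \<open>Since \<open>ln pi \<ge> 1\<close>, the logarithm is at least \<open>d\<close>;
    its power therefore cancels the factorial in the denominator of \<open>const3\<close>.\<close>
  have ln2: "(ln (1 * pi ^ d * real m)) ^ (d - 1) \<ge> fact (d - 1)"
  proof -
    have "ln pi \<ge> ln (exp 1)" using exp_le pi_gt3 by (intro ln_mono) auto
    then have "real d * 1 + 0 \<le> real d * ln pi + ln (real m)"
      using m by (intro add_mono mult_left_mono) auto
    then have "real d \<le> ln (1 * pi ^ d * real m)"
      using m by (simp add: ln_mult ln_realpow)
    then have "real (d - 1) ^ (d - 1) \<le> (ln (1 * pi ^ d * real m)) ^ (d - 1)"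
      by (intro power_mono) auto
    then show ?thesis using fact_le_self_power[of "d - 1"] by linarith
  qed
  define q where "q = S / \<delta>\<^sup>2"
  have q: "q > 0" using S \<delta> by (simp add: q_def)
  \<comment> \<open>\<open>exp 2000\<close> is a square, so that the square root of \<open>m\<close>
    brings the summand 1000 into the logarithm.\<close>
  have "(q * exp 1000 * (4 / pi) ^ d)\<^sup>2 = S\<^sup>2 * (exp 2000 * 1 / fact (d - 1) * (4 / pi) ^ (2 * d) / \<delta> ^ 4 * 1 * 1 * fact (d - 1))"
    unfolding power_mult_distrib power_even_eq[symmetric] exp_double[symmetric]
    by (simp add: q_def power_divide mult_ac)
  also have "\<dots> \<le> S\<^sup>2 * (exp 2000 * (real d + 1) / fact (d - 1) * (4 / pi) ^ (2 * d) / \<delta> ^ 4 * \<Lambda> * ln (\<Lambda> / (\<gamma> * \<delta>))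
          * (ln (1 * pi ^ d * real m)) ^ (d - 1))"
    using ln1 ln2 \<Lambda> \<delta>
    by (intro mult_left_mono mult_mono divide_right_mono mult_nonneg_nonneg divide_nonneg_nonneg) auto
  also have "\<dots> \<le> real m" using m_large unfolding const3_def .
  also have "\<dots> \<le> real m / \<gamma>\<^sub>0" using \<gamma>0 divide_left_mono[of \<gamma>\<^sub>0 1 "real m"] by simp
  finally have "q * exp 1000 * (4 / pi) ^ d \<le> sqrt (real m / \<gamma>\<^sub>0)"
    by (rule real_le_rsqrt)
  then have "pi ^ d / 4 ^ d * (q * exp 1000 * (4 / pi) ^ d) \<le> pi ^ d / 4 ^ d * sqrt (real m / \<gamma>\<^sub>0)"
    by (intro mult_left_mono) auto
  moreover have "pi ^ d / 4 ^ d * (q * exp 1000 * (4 / pi) ^ d) = q * exp 1000"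
    by (simp add: power_divide)
  ultimately have "ln (q * exp 1000) \<le> ln (pi ^ d / 4 ^ d * sqrt (real m / \<gamma>\<^sub>0))"
    using q by (intro ln_mono) auto
  moreover have "ln (q * exp 1000) = ln q + 1000" using q by (subst ln_mult) auto
  ultimately show ?thesis by (simp add: q_def)
qed

text \<open>The crude right side is shaped like the factor that the first term of the maximum
  offers. As \<open>ln (2 * N) \<ge> 1 / 2\<close>, its square absorbs both the linear term and the
  constant.\<close>

lemma log_union_bound:
  fixes N \<gamma> :: real
  assumes N: "N \<ge> 1" and \<gamma>: "0 < \<gamma>" "\<gamma> < 1"
  shows "ln (2 * N\<^sup>2 / \<gamma>) \<le> 8 * (ln (2 * N))\<^sup>2 / \<gamma>"
proof -
  define l where "l = ln (2 * N)"
  have "ln 2 \<le> l" unfolding l_def using N by (intro ln_mono) auto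
  then have l: "1 / 2 \<le> l" using ln2_ge_two_thirds by linarith
  have "2 * N\<^sup>2 / \<gamma> \<le> (2 * N)\<^sup>2 * (1 / \<gamma>)" using \<gamma> by (simp add: divide_right_mono power_mult_distrib)
  then have "ln (2 * N\<^sup>2 / \<gamma>) \<le> ln ((2 * N)\<^sup>2 * (1 / \<gamma>))"
    using N \<gamma> by (intro ln_mono) auto
  also have "\<dots> = 2 * l + ln (1 / \<gamma>)"
    using N \<gamma> ln_realpow[of 2 2] by (simp add: ln_mult ln_realpow l_def ln_div)
  also have "\<dots> \<le> 4 * l\<^sup>2 / \<gamma> + 4 * l\<^sup>2 / \<gamma>"
  proof (rule add_mono)
    have "4 * l\<^sup>2 \<le> 4 * l\<^sup>2 / \<gamma>" using \<gamma> divide_left_mono[of \<gamma> 1 "4 * l\<^sup>2"] by simp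
    moreover have "2 * l \<le> 4 * l\<^sup>2" using l by (simp add: power2_eq_square)
    ultimately show "2 * l \<le> 4 * l\<^sup>2 / \<gamma>" by linarith
    have "1 \<le> 4 * l\<^sup>2" using l power_mono[of "1 / 2" l 2] by (simp add: power2_eq_square)
    then have "1 / \<gamma> \<le> 4 * l\<^sup>2 / \<gamma>" using \<gamma> by (intro divide_right_mono) auto
    moreover have "ln (1 / \<gamma>) \<le> 1 / \<gamma> - 1" using \<gamma> by (intro ln_le_minus_one) auto
    ultimately show "ln (1 / \<gamma>) \<le> 4 * l\<^sup>2 / \<gamma>" by linarith
  qed
  finally show ?thesis by (simp add: l_def)
qed

text \<open>The numerical factors multiply to \<open>4 * 3 * 864 * 8 * 9 = 746496\<close>, the 9
  coming from \<open>\<epsilon>^2\<close>; the constant \<open>10 ^ 6\<close> covers this. The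
  argument produces \<open>\<delta>^2\<close> in the denominator, and \<open>\<delta> ^ 12\<close>
  is smaller.\<close>

lemma sample_size_sufficient:
  fixes S \<delta> \<gamma>\<^sub>0 \<Lambda> L R N V :: real
  assumes S: "S \<ge> 1" and \<delta>: "0 < \<delta>" "\<delta> < 1" and \<gamma>0: "0 < \<gamma>\<^sub>0" "\<gamma>\<^sub>0 < 1" and N: "N \<ge> 1"
    and V: "0 \<le> V" "V \<le> 3 * (864 * R) ^ d" and R: "(864 * R) ^ d \<le> 864 * (\<Lambda>\<^sup>2 * L ^ (4 * d - 4))"
    and \<epsilon>: "\<epsilon> = \<delta> / (3 * S)"
    and m_large: "real m \<ge> S\<^sup>2 * (const1 (10 ^ 6) d / (\<delta> ^ 12 * \<gamma>\<^sub>0) * \<Lambda>\<^sup>2 * (ln (2 * N))\<^sup>2 * L ^ (4 * d - 4))"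
  shows "4 * V / \<epsilon>\<^sup>2 * ln (2 * N\<^sup>2 / \<gamma>\<^sub>0) \<le> real m"
proof -
  define Z where "Z = \<Lambda>\<^sup>2 * L ^ (4 * d - 4)"
  define l where "l = (ln (2 * N))\<^sup>2"
  have "1 \<le> N\<^sup>2" using N by (intro one_le_power) auto
  then have N2: "\<gamma>\<^sub>0 \<le> 2 * N\<^sup>2" using \<gamma>0 by linarith
  have Z: "0 \<le> Z" unfolding Z_def by (auto intro!: mult_nonneg_nonneg zero_le_even_power)
  have l: "0 \<le> l" by (simp add: l_def)
  have "4 * V / \<epsilon>\<^sup>2 * ln (2 * N\<^sup>2 / \<gamma>\<^sub>0) \<le> 4 * (3 * (864 * Z)) / \<epsilon>\<^sup>2 * (8 * l / \<gamma>\<^sub>0)"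
    unfolding l_def
    by (rule mult_mono[OF _ log_union_bound[OF N \<gamma>0]])
      (use V R Z N N2 \<gamma>0 in \<open>auto simp: Z_def intro!: divide_right_mono ln_ge_zero\<close>)
  also have "\<dots> = S\<^sup>2 * (746496 / (\<delta>\<^sup>2 * \<gamma>\<^sub>0) * Z * l)"
    using S \<delta> by (simp add: \<epsilon> field_simps power2_eq_square)
  also have "\<dots> \<le> S\<^sup>2 * (const1 (10 ^ 6) d / (\<delta> ^ 12 * \<gamma>\<^sub>0) * Z * l)"
  proof (intro mult_left_mono mult_right_mono frac_le Z l)
    have "(4 / pi) ^ (4 * d) \<ge> 1" using pi_less_4 by (intro one_le_power) simp
    then show "746496 \<le> const1 (10 ^ 6) d" by (simp add: const1_def)
    show "\<delta> ^ 12 \<le> \<delta>\<^sup>2" using \<delta> by (intro power_decreasing) auto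
  qed (use \<delta> \<gamma>0 in \<open>auto simp: const1_def\<close>)
  also have "\<dots> \<le> real m" using m_large by (simp add: Z_def l_def mult_ac)
  finally show ?thesis .
qed

section \<open>Choice of the universal constants and conclusion\<close>

theorem theorem4p2:
  shows "\<exists>C1 C2 C3 C4 C5 C6 :: real.
    C1 > 0 \<and> C2 > 0 \<and> C3 > 0 \<and> C4 > 0 \<and> C5 > 0 \<and> C6 > 0 \<and>
    (\<forall>(d :: nat) (J :: (nat \<Rightarrow> nat) set) (N :: nat) (\<alpha> :: real) (s :: nat)
       (\<delta> :: real) (\<gamma> :: real) (\<gamma>\<^sub>0 :: real) (s\<^sub>\<alpha> :: real) (\<Lambda> :: real) (m :: nat).
      d \<ge> 1 \<longrightarrow> J \<subseteq> multi_indices d \<longrightarrow> finite J \<longrightarrow> N = card J \<longrightarrow>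
      \<alpha> > 1 \<longrightarrow> 1 \<le> s \<longrightarrow> s \<le> N \<longrightarrow>
      0 < \<delta> \<longrightarrow> \<delta> < 1 \<longrightarrow> 0 < \<gamma> \<longrightarrow> 0 < \<gamma>\<^sub>0 \<longrightarrow> \<gamma> + \<gamma>\<^sub>0 < 1 \<longrightarrow>
      s\<^sub>\<alpha> = (1 + \<alpha>)\<^sup>2 * real s \<longrightarrow>
      \<Lambda> = ln (const4 C4 d * s\<^sub>\<alpha> powr (3 / 2) / \<delta>\<^sup>2) \<longrightarrow>
      m \<ge> 1 \<longrightarrow>
      real m \<ge> s\<^sub>\<alpha>\<^sup>2 * Max {
        const1 C1 d / (\<delta> ^ 12 * \<gamma>\<^sub>0) * \<Lambda>\<^sup>2 * (ln (2 * real N))\<^sup>2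
          * (ln (pi ^ d / 4 ^ d * sqrt (real m / \<gamma>\<^sub>0))) ^ (4 * d - 4),
        const2 C2 d / \<delta> powr (15 / 2) * \<Lambda> powr (3 / 2) * ln (2 * real N)
          * (ln (C5 * real m * (pi / 4) ^ d)) ^ (d - 1),
        const3 C3 d / \<delta> ^ 4 * \<Lambda> * ln (\<Lambda> / (\<gamma> * \<delta>))
          * (ln (C6 * pi ^ d * real m)) ^ (d - 1)} \<longrightarrow>
      \<P>(y in uniform_samples d m.
          \<forall>z \<in> sparse_cone J s \<alpha> - {\<lambda>_. 0}.
            (L2_set (mat_vec J (sampling_matrix d m y) z) {1..m})\<^sup>2
              > (1 - \<delta>) * (L2_set z J)\<^sup>2)
        > 1 - (\<gamma> + \<gamma>\<^sub>0))"
proof (intro exI conjI allI impI)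
  \<comment> \<open>\<open>C1\<close> absorbs the numerical factors of
    \<open>sample_size_sufficient\<close>, \<open>C3 = exp 2000\<close> lifts the logarithm
    \<open>L\<close> above 1000 and so above 864, and \<open>C4 = exp 3\<close> gives
    \<open>\<Lambda> \<ge> 3 + ln (S / \<delta>)\<close>. The other three are 1.\<close>
  show "(10 ^ 6 :: real) > 0" "(1 :: real) > 0" "exp 2000 > (0 :: real)" "exp 3 > (0 :: real)"
    "(1 :: real) > 0" "(1 :: real) > 0"
    by simp_all
  fix d :: nat and J :: "(nat \<Rightarrow> nat) set" and N s m :: nat and \<alpha> \<delta> \<gamma> \<gamma>\<^sub>0 S \<Lambda> :: real
  assume d: "d \<ge> 1" and J: "J \<subseteq> multi_indices d" "finite J" and N: "N = card J"
    and \<alpha>: "\<alpha> > 1" and s: "1 \<le> s" "s \<le> N" and \<delta>: "0 < \<delta>" "\<delta> < 1"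
    and \<gamma>: "0 < \<gamma>" and \<gamma>0: "0 < \<gamma>\<^sub>0" and sum1: "\<gamma> + \<gamma>\<^sub>0 < 1"
    and S_def: "S = (1 + \<alpha>)\<^sup>2 * real s"
    and \<Lambda>_def: "\<Lambda> = ln (const4 (exp 3) d * S powr (3 / 2) / \<delta>\<^sup>2)" and m: "m \<ge> 1"
  define L where "L = ln (pi ^ d / 4 ^ d * sqrt (real m / \<gamma>\<^sub>0))"
  let ?T1 = "const1 (10 ^ 6) d / (\<delta> ^ 12 * \<gamma>\<^sub>0) * \<Lambda>\<^sup>2 * (ln (2 * real N))\<^sup>2 * L ^ (4 * d - 4)"
  let ?T3 = "const3 (exp 2000) d / \<delta> ^ 4 * \<Lambda> * ln (\<Lambda> / (\<gamma> * \<delta>)) * (ln (1 * pi ^ d * real m)) ^ (d - 1)"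
  assume max: "real m \<ge> S\<^sup>2 * Max {
        const1 (10 ^ 6) d / (\<delta> ^ 12 * \<gamma>\<^sub>0) * \<Lambda>\<^sup>2 * (ln (2 * real N))\<^sup>2
          * (ln (pi ^ d / 4 ^ d * sqrt (real m / \<gamma>\<^sub>0))) ^ (4 * d - 4),
        const2 1 d / \<delta> powr (15 / 2) * \<Lambda> powr (3 / 2) * ln (2 * real N)
          * (ln (1 * real m * (pi / 4) ^ d)) ^ (d - 1), ?T3}"
  have T1: "real m \<ge> S\<^sup>2 * ?T1"
    by (rule order_trans[OF mult_left_mono max]) (auto simp: L_def intro!: Max_ge)
  have T3: "real m \<ge> S\<^sup>2 * ?T3"
    by (rule order_trans[OF mult_left_mono max]) (auto intro!: Max_ge)
  have "(1 + \<alpha>)\<^sup>2 * real s \<ge> 1 * 1" using \<alpha> s by (intro mult_mono one_le_power) auto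
  then have S: "S \<ge> 1" by (simp add: S_def)
  have \<Lambda>_ge: "\<Lambda> \<ge> ln (exp 3 * (S / \<delta>))"
    unfolding \<Lambda>_def
  proof (rule ln_mono)
    have c4: "exp 3 \<le> const4 (exp 3) d" by (rule const4_ge) simp
    then have c40: "0 \<le> const4 (exp 3) d" using exp_gt_zero[of "3 :: real"] by linarith
    have "S powr 1 \<le> S powr (3 / 2)" using S by (intro powr_mono) auto
    then have "exp 3 * S \<le> const4 (exp 3) d * S powr (3 / 2)"
      using S c4 c40 by (intro mult_mono) auto
    moreover have "\<delta>\<^sup>2 \<le> \<delta>" using \<delta> by (simp add: power2_eq_square)
    ultimately have "exp 3 * S / \<delta> \<le> const4 (exp 3) d * S powr (3 / 2) / \<delta>\<^sup>2"
      using S \<delta> by (intro frac_le) (auto intro: mult_nonneg_nonneg c40)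
    then show "exp 3 * (S / \<delta>) \<le> const4 (exp 3) d * S powr (3 / 2) / \<delta>\<^sup>2" by simp
  qed (use S \<delta> in auto)
  also have "ln (exp 3 * (S / \<delta>)) = 3 + ln (S / \<delta>)" using S \<delta> by (subst ln_mult) auto
  finally have \<Lambda>_ge': "\<Lambda> \<ge> 3 + ln (S / \<delta>)" .
  have S\<delta>: "S / \<delta> \<ge> 1" using S \<delta> by simp
  then have "ln (S / \<delta>) \<ge> 0" by simp
  with \<Lambda>_ge' have \<Lambda>3: "\<Lambda> \<ge> 3" by linarith
  have L_ge: "L \<ge> 1000 + ln (S / \<delta>\<^sup>2)"
    unfolding L_def by (rule log_term_large[OF d m _ \<delta> \<gamma> _ \<gamma>0 _ \<Lambda>3 T3]) (use S \<gamma> \<gamma>0 sum1 in auto)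
  have "S / \<delta>\<^sup>2 \<ge> S / \<delta>" using S \<delta> by (intro frac_le) (auto simp: power2_eq_square)
  then have "ln (S / \<delta>\<^sup>2) \<ge> ln (S / \<delta>)" using S \<delta> by (intro ln_mono) auto
  then have L_ge': "L \<ge> 1000 + ln (S / \<delta>)" using L_ge by linarith
  \<comment> \<open>For \<open>d = 1\<close> the power \<open>L ^ (4 * d - 4)\<close> is 1, so
    \<open>\<Lambda>^2\<close> has to cover \<open>R\<close>. For \<open>d \<ge> 2\<close> one has
    \<open>4 d - 4 \<ge> 2 d\<close>, and \<open>L \<ge> 864\<close> yields
    \<open>(864 L) ^ d \<le> L ^ (2 d)\<close>.\<close>
  define R where "R = (if d = 1 then \<Lambda> else L)"
  have R: "R \<ge> 3 + ln (S / \<delta>)" "R \<ge> 1"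
    using \<Lambda>_ge' L_ge' \<open>ln (S / \<delta>) \<ge> 0\<close> by (auto simp: R_def)
  have R_pow: "(864 * R) ^ d \<le> 864 * (\<Lambda>\<^sup>2 * L ^ (4 * d - 4))"
  proof (cases "d = 1")
    case True
    have "\<Lambda> \<le> \<Lambda>\<^sup>2" using \<Lambda>3 by (simp add: power2_eq_square)
    then show ?thesis by (simp add: True R_def)
  next
    case False
    have L: "L \<ge> 864" using L_ge' \<open>ln (S / \<delta>) \<ge> 0\<close> by linarith
    have "(864 * L) ^ d \<le> (L * L) ^ d" using L by (intro power_mono mult_right_mono) auto
    also have "\<dots> = L ^ (2 * d)" by (simp add: power_mult power2_eq_square)
    also have "\<dots> \<le> L ^ (4 * d - 4)" using L d False by (intro power_increasing) auto
    also have "\<dots> \<le> 864 * \<Lambda>\<^sup>2 * L ^ (4 * d - 4)"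
    proof -
      have "1 \<le> \<Lambda>\<^sup>2" using \<Lambda>3 by (intro one_le_power) auto
      then show ?thesis using L by (simp add: mult_le_cancel_right1)
    qed
    finally show ?thesis using False by (simp add: R_def mult.assoc)
  qed
  define \<eta> where "\<eta> = 1 / (4 * R)"
  define \<epsilon> where "\<epsilon> = \<delta> / (3 * S)"
  define V where "V = (8 / \<eta>) ^ d * ((4 / \<eta>) ^ d / \<epsilon>) powr (2 * \<eta> / (1 - 2 * \<eta>))"
  have \<eta>: "0 < \<eta>" "\<eta> < 1 / 2" using R by (auto simp: \<eta>_def field_simps)
  \<comment> \<open>The factor 3 in \<open>\<epsilon>\<close> costs \<open>ln 3 \<le> 2\<close>,
    which the summand 3 in the lower bound for \<open>R\<close> covers.\<close>
  have "ln (1 / \<epsilon>) = ln 3 + ln (S / \<delta>)"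
    using S \<delta> by (simp add: \<epsilon>_def ln_mult ln_div)
  also have "\<dots> \<le> R" using R ln_le_minus_one[of 3] by simp
  finally have V: "V \<le> 3 * (864 * R) ^ d"
    unfolding V_def using S \<delta>
    by (intro truncation_variance_bound[OF R(2) _ _ _ \<eta>_def]) (auto simp: \<epsilon>_def field_simps)
  have V0: "0 \<le> V" using \<eta> by (simp add: V_def)
  have "4 * V / \<epsilon>\<^sup>2 * ln (2 * (real (card J))\<^sup>2 / \<gamma>\<^sub>0) \<le> real m"
    unfolding N[symmetric]
    by (rule sample_size_sufficient[OF S \<delta> \<gamma>0 _ _ V0 V R_pow \<epsilon>_def T1]) (use s \<gamma> sum1 in auto)
  then have "\<P>(y in uniform_samples d m. \<forall>z \<in> sparse_cone J s \<alpha> - {\<lambda>_. 0}.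
            (L2_set (mat_vec J (sampling_matrix d m y) z) {1..m})\<^sup>2
              > (1 - \<delta>) * (L2_set z J)\<^sup>2) \<ge> 1 - \<gamma>\<^sub>0"
    using \<alpha> s \<delta> \<gamma>0
    by (intro lower_rip_probability[OF J m _ _ _ \<eta> \<epsilon>_def[unfolded S_def] V_def]) auto
  \<comment> \<open>All failure is charged to \<open>\<gamma>\<^sub>0\<close>; positivity of
    \<open>\<gamma>\<close> makes the inequality strict.\<close>
  then show "\<P>(y in uniform_samples d m. \<forall>z \<in> sparse_cone J s \<alpha> - {\<lambda>_. 0}.
            (L2_set (mat_vec J (sampling_matrix d m y) z) {1..m})\<^sup>2
              > (1 - \<delta>) * (L2_set z J)\<^sup>2) > 1 - (\<gamma> + \<gamma>\<^sub>0)"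
    using \<gamma> by linarith
qed

end
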